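(* Let $(E,d)$ be a compact metric space and let $(\mu_x)_{x\in E}$ be a collection of probability measures on $\mathrm{Lip}(E,E)$ depending continuously on $x$. Let $P$ be the transition operator defined, for any bounded Borel function $\varphi:E\to\mathbb C$ and any $x\in E$, by $P\varphi(x)=\int_{\mathrm{Lip}(E,E)}\varphi(T(x))\,\mu_x(\mathrm dT)$. Assume that there exists $\alpha\in(0,1]$ such that: 1. $\displaystyle r:=\sup_{x,y\in E,\ x\neq y}\int_{\mathrm{Lip}(E,E)}\Bigl(\frac{d(T(x),T(y))}{d(x,y)}\Bigr)^{\alpha}\mu_x(\mathrm dT)<1$; 2. $\displaystyle R_\alpha:=\sup_{x,y\in E,\ x\neq y}\frac{|\mu_x-\mu_y|}{d(x,y)^\alpha}<+\infty$; 3. there exist $\delta>0$ and a probability measure $\mu$ on $\mathrm{Lip}(E,E)$ such that $\mu_x\ge\delta\mu$ for all $x\in E$, and the closed semigroup $T_\mu$ generated by the support $S_\mu$ of $\mu$ possesses a contracting sequence. Then there exists on $E$ a unique $P$-invariant probability measure $\nu$; furthermore, there exist constants $\kappa>0$ and $\rho\in\,]0,1[$ such that $$\forall\varphi\in\mathcal H_\alpha(E),\ \forall x\in E,\ \forall n\ge 0,\qquad |P^n\varphi(x)-\nu(\varphi)|\le\kappa\,\rho^n\,\|\varphi\|_\alpha.$$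
   Context: $C(E,E)$ is the set of continuous maps $E\to E$ with the topology of uniform convergence. $\mathrm{Lip}(E,E)\subset C(E,E)$ is the set of Lipschitz maps $E\to E$, i.e. maps $f$ with $\sup_{x\ne y}d(f(x),f(y))/d(x,y)<\infty$; measures on it are Borel measures, and supports and closures are taken with respect to uniform convergence. $|\mu_x-\mu_y|$ is the total variation (norm) of the signed measure $\mu_x-\mu_y$. The closed semigroup $T_\mu$ generated by $S_\mu$ is the closure in $C(E,E)$ of the set of all finite compositions $T_q\circ\cdots\circ T_1$ with $q\ge1$ and $T_1,\dots,T_q\in S_\mu$. A sequence $(\xi_n)_{n\ge0}$ of continuous functions from $E$ to $E$ is a contracting sequence if there exists $x_0\in E$ such that $\lim_{n\to+\infty}\xi_n(x)=x_0$ for every $x\in E$. $\mathcal H_\alpha(E)$ is the space of $\alpha$-Hölder continuous functions $f:E\to\mathbb C$, with norm $\|f\|_\alpha=|f|_\infty+m_\alpha(f)$, where $|f|_\infty=\sup_E|f|$ and $m_\alpha(f)=\sup_{x\neq y}|f(x)-f(y)|/d(x,y)^\alpha$. $\nu(\varphi)=\int_E\varphi\,\mathrm d\nu$, and $\nu$ is $P$-invariant if $\nu(P\varphi)=\nu(\varphi)$ for all bounded Borel $\varphi$. *)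

theory Defs
  imports "HOL-Probability.Probability"
begin

text \<open>
  The space \<open>E\<close> is a type \<open>'a::metric_space\<close> with \<open>compact UNIV\<close>. Every continuous map
  on it is bounded, so \<open>'a \<Rightarrow>\<^sub>C 'a\<close>, whose metric is the supremum distance, is \<open>C(E,E)\<close> with the
  topology of uniform convergence. Suprema of nonnegative quantities are taken in \<^typ>\<open>ennreal\<close>, so
  that they always exist, the supremum over the empty set (when \<open>E\<close> is a single point) being \<open>0\<close>.
\<close>

definition Lip_maps :: "('a::metric_space \<Rightarrow>\<^sub>C 'a) set" where
  "Lip_maps = {T. \<exists>C. C-lipschitz_on UNIV (apply_bcontfun T)}"

definition prob_on_Lip :: "('a::metric_space \<Rightarrow>\<^sub>C 'a) measure \<Rightarrow> bool" where
  "prob_on_Lip m \<longleftrightarrow> prob_space m \<and> sets m = sets (restrict_space borel Lip_maps)"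

text \<open>Continuity of \<open>x \<mapsto> \<mu>\<^sub>x\<close> for the weak (narrow) topology on probability measures.\<close>

definition weakly_continuous_family ::
    "('a::metric_space \<Rightarrow> ('a \<Rightarrow>\<^sub>C 'a) measure) \<Rightarrow> bool" where
  "weakly_continuous_family \<mu> \<longleftrightarrow>
     (\<forall>F :: ('a \<Rightarrow>\<^sub>C 'a) \<Rightarrow> real. continuous_on Lip_maps F \<and> bounded (F ` Lip_maps) \<longrightarrow>
        continuous_on UNIV (\<lambda>x. \<integral>T. F T \<partial>\<mu> x))"

definition transition_op ::
    "('a::metric_space \<Rightarrow> ('a \<Rightarrow>\<^sub>C 'a) measure) \<Rightarrow> ('a \<Rightarrow> complex) \<Rightarrow> 'a \<Rightarrow> complex" where
  "transition_op \<mu> \<phi> x = (\<integral>T. \<phi> (apply_bcontfun T x) \<partial>\<mu> x)"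

definition invariant_prob ::
    "('a::metric_space \<Rightarrow> ('a \<Rightarrow>\<^sub>C 'a) measure) \<Rightarrow> 'a measure \<Rightarrow> bool" where
  "invariant_prob \<mu> \<nu> \<longleftrightarrow> prob_space \<nu> \<and> sets \<nu> = sets borel \<and>
     (\<forall>\<phi> \<in> borel_measurable borel. bounded (range \<phi>) \<longrightarrow>
        (\<integral>x. transition_op \<mu> \<phi> x \<partial>\<nu>) = (\<integral>x. \<phi> x \<partial>\<nu>))"

text \<open>Total variation norm of the signed measure \<open>M - N\<close>, for finite measures \<open>M\<close> and \<open>N\<close> on the
  same measurable space.\<close>

definition tv_norm :: "'b measure \<Rightarrow> 'b measure \<Rightarrow> ennreal" where
  "tv_norm M N =
     (SUP \<A> \<in> {\<A>. finite \<A> \<and> \<A> \<subseteq> sets M \<and> partition_on (space M) \<A>}.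
        \<Sum>A\<in>\<A>. ennreal \<bar>measure M A - measure N A\<bar>)"

definition measure_support :: "'b::topological_space measure \<Rightarrow> 'b set" where
  "measure_support m = {T \<in> space m. \<forall>U. open U \<and> T \<in> U \<longrightarrow> emeasure m (U \<inter> space m) > 0}"

definition bcomp :: "('a::metric_space \<Rightarrow>\<^sub>C 'a) \<Rightarrow> ('a \<Rightarrow>\<^sub>C 'a) \<Rightarrow> ('a \<Rightarrow>\<^sub>C 'a)" where
  "bcomp f g = Bcontfun (apply_bcontfun f \<circ> apply_bcontfun g)"

lemma apply_bcomp [simp]: "apply_bcontfun (bcomp f g) x = apply_bcontfun f (apply_bcontfun g x)"
proof -
  have "continuous_on UNIV (apply_bcontfun f \<circ> apply_bcontfun g)"
    by (rule continuous_on_compose) auto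
  moreover have "bounded (range (apply_bcontfun f \<circ> apply_bcontfun g))"
    by (rule bounded_subset[OF bounded_apply_bcontfun[of f]]) auto
  ultimately show ?thesis
    by (simp add: bcomp_def Bcontfun_inverse bcontfun_def)
qed

inductive_set finite_compositions :: "('a::metric_space \<Rightarrow>\<^sub>C 'a) set \<Rightarrow> ('a \<Rightarrow>\<^sub>C 'a) set"
  for S where
  base: "T \<in> S \<Longrightarrow> T \<in> finite_compositions S"
| step: "T \<in> S \<Longrightarrow> U \<in> finite_compositions S \<Longrightarrow> bcomp T U \<in> finite_compositions S"

definition closed_semigroup :: "('a::metric_space \<Rightarrow>\<^sub>C 'a) set \<Rightarrow> ('a \<Rightarrow>\<^sub>C 'a) set" where
  "closed_semigroup S = closure (finite_compositions S)"

definition contracting_sequence :: "(nat \<Rightarrow> 'a::metric_space \<Rightarrow>\<^sub>C 'a) \<Rightarrow> bool" where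
  "contracting_sequence \<xi> \<longleftrightarrow> (\<exists>x0. \<forall>x. (\<lambda>n. apply_bcontfun (\<xi> n) x) \<longlonglongrightarrow> x0)"

definition hoelder_seminorm :: "real \<Rightarrow> ('a::metric_space \<Rightarrow> complex) \<Rightarrow> ennreal" where
  "hoelder_seminorm \<alpha> f =
     (SUP (x, y) \<in> {(x, y). x \<noteq> y}. ennreal (cmod (f x - f y) / dist x y powr \<alpha>))"

definition hoelder_norm :: "real \<Rightarrow> ('a::metric_space \<Rightarrow> complex) \<Rightarrow> ennreal" where
  "hoelder_norm \<alpha> f = (SUP x. ennreal (cmod (f x))) + hoelder_seminorm \<alpha> f"

definition hoelder_space :: "real \<Rightarrow> ('a::metric_space \<Rightarrow> complex) set" where
  "hoelder_space \<alpha> = {f. hoelder_seminorm \<alpha> f < \<infinity>}"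

end

theory Submission imports Defs begin

text \<open>
  The two regularity hypotheses give a Lasota--Yorke inequality: if \<open>f\<close> has oscillation at most \<open>a\<close>
  and Hoelder constant at most \<open>b\<close>, then \<open>P f\<close> has oscillation at most \<open>a\<close> and Hoelder constant at
  most \<open>r b + R a\<close>. Hence for large \<open>K\<close> the class of functions with oscillation at most \<open>1\<close> and Hoelder
  constant at most \<open>K\<close> is \<open>P\<close>-stable, and only the oscillation remains to be contracted. Since
  \<open>\<mu>\<^sub>x \<ge> \<delta> \<mu>\<close>, two chains started at \<open>x\<close> and \<open>y\<close> can be driven for a while by the same maps drawn
  from \<open>\<mu>\<close>; the contracting sequence makes these maps bring the two points close together with positive
  probability, and there the Hoelder bound yields a gain. By compactness of \<open>E \<times> E\<close> the gain is
  uniform, so a power of \<open>P\<close> strictly contracts the class, which gives uniqueness and the geometric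
  rate. An invariant measure is a weak limit of the laws of the chain; it is obtained from Helly's
  theorem after coding \<open>E\<close> into the real line by a Borel map with uniformly continuous inverse.
\<close>

subsection \<open>Weak compactness of probability measures on a compact metric space\<close>

text \<open>At the first index \<open>i\<close> where the digits differ the term has absolute value
  \<open>1 / 3 ^ i\<close>, while all later terms together amount to at most half of that. Base 3 is
  what keeps the tail from cancelling the leading term; in base 2 it could.\<close>

lemma ternary_code_separates:
  fixes u v :: "nat \<Rightarrow> bool"
  assumes "\<exists>i<N. u i \<noteq> v i"
  shows "1 / (2 * 3 ^ N) \<le> \<bar>(\<Sum>i. of_bool (u i) / 3 ^ i) - (\<Sum>i. of_bool (v i) / 3 ^ i :: real)\<bar>"
proof -
  obtain i where i: "u i \<noteq> v i" "i < N" and below: "\<And>j. j < i \<Longrightarrow> u j = v j"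
  proof -
    obtain k where k: "k < N" "u k \<noteq> v k"
      using assms by blast
    obtain i where "u i \<noteq> v i" "\<forall>j<i. u j = v j"
      using exists_least_iff[of "\<lambda>i. u i \<noteq> v i"] k(2) by auto
    moreover from this k have "i < N"
      by (metis le_less_trans not_le)
    ultimately show ?thesis
      using that by blast
  qed
  define d :: "nat \<Rightarrow> real" where "d j = of_bool (u j) / 3 ^ j - of_bool (v j) / 3 ^ j" for j
  have geo: "summable (\<lambda>j. 1 / 3 ^ j :: real)"
    using summable_geometric[of "1/3::real"] by (simp add: power_divide)
  have sm: "summable (\<lambda>j. of_bool (w j) / 3 ^ j :: real)" for w :: "nat \<Rightarrow> bool"
    by (rule summable_comparison_test'[OF geo]) (auto simp: divide_right_mono)
  have sd: "summable d"
    unfolding d_def by (intro summable_diff sm)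
  have dle: "\<bar>d j\<bar> \<le> 1 / 3 ^ j" for j
    unfolding d_def by (auto simp: of_bool_def)
  have geo': "(\<lambda>j. 1 / 3 ^ (j + Suc i) :: real) sums (1 / (2 * 3 ^ i))"
  proof -
    have "(\<lambda>j. 1 / 3 ^ Suc i * (1 / 3) ^ j :: real) sums (1 / 3 ^ Suc i * (1 / (1 - 1 / 3)))"
      by (intro sums_mult geometric_sums) simp
    moreover have "(\<lambda>j. 1 / 3 ^ Suc i * (1 / 3) ^ j :: real) = (\<lambda>j. 1 / 3 ^ (j + Suc i))"
      by (simp add: power_add power_one_over mult_ac)
    moreover have "1 / 3 ^ Suc i * (1 / (1 - 1 / 3)) = (1 / (2 * 3 ^ i) :: real)"
      by simp
    ultimately show ?thesis
      by metis
  qed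
  have "summable (\<lambda>j. \<bar>d (j + Suc i)\<bar>)"
    by (rule summable_comparison_test'[OF sums_summable[OF geo']]) (simp only: real_norm_def abs_abs dle)
  then have "\<bar>\<Sum>j. d (j + Suc i)\<bar> \<le> (\<Sum>j. 1 / 3 ^ (j + Suc i))"
    by (intro order_trans[OF summable_rabs] suminf_le dle sums_summable[OF geo'])
  then have tail: "\<bar>\<Sum>j. d (j + Suc i)\<bar> \<le> 1 / (2 * 3 ^ i)"
    using sums_unique[OF geo'] by simp
  have "(\<Sum>j. d j) = (\<Sum>j. d (j + Suc i)) + (\<Sum>j<Suc i. d j)"
    by (rule suminf_split_initial_segment[OF sd])
  also have "(\<Sum>j<Suc i. d j) = d i"
    using below by (simp add: d_def)
  finally have eq: "(\<Sum>j. d j) = (\<Sum>j. d (j + Suc i)) + d i" .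
  have "\<bar>d i\<bar> = 1 / 3 ^ i"
    using i(1) by (auto simp: d_def of_bool_def)
  with eq tail have "1 / 3 ^ i - 1 / (2 * 3 ^ i) \<le> \<bar>\<Sum>j. d j\<bar>"
    by linarith
  moreover have "1 / (2 * 3 ^ N) \<le> 1 / 3 ^ i - 1 / (2 * 3 ^ i :: real)"
  proof -
    have "(3::real) ^ i \<le> 3 ^ N"
      using i(2) by (intro power_increasing) auto
    then have "1 / (2 * 3 ^ N) \<le> 1 / (2 * 3 ^ i :: real)"
      by (intro divide_left_mono) auto
    then show ?thesis
      by simp
  qed
  moreover have "(\<Sum>j. d j) = (\<Sum>i. of_bool (u i) / 3 ^ i) - (\<Sum>i. of_bool (v i) / 3 ^ i :: real)"
    unfolding d_def by (rule suminf_diff[OF sm sm, symmetric])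
  ultimately show ?thesis
    by linarith
qed

text \<open>The sets are the balls of radius \<open>1 / Suc n\<close> around finite nets, listed in
  one sequence. Two points that agree on all balls of one scale share a ball of that scale, and
  these finitely many balls lie in an initial segment of the list.\<close>

lemma compact_separating_sequence:
  assumes "compact (UNIV :: 'a::metric_space set)"
  obtains B :: "nat \<Rightarrow> 'a::metric_space set" where "\<And>i. open (B i)"
    "\<And>e. 0 < e \<Longrightarrow> \<exists>N. \<forall>x y. (\<forall>i<N. x \<in> B i \<longleftrightarrow> y \<in> B i) \<longrightarrow> dist x y < e"
proof -
  have "\<exists>F :: 'a::metric_space set. finite F \<and> UNIV \<subseteq> (\<Union>q\<in>F. ball q (1 / real (Suc n)))" for n
    using compact_eq_totally_bounded[THEN iffD1, OF assms]
    by (metis of_nat_0_less_iff zero_less_Suc zero_less_divide_1_iff)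
  then obtain F :: "nat \<Rightarrow> 'a set"
    where F: "\<And>n. finite (F n)" "\<And>n. UNIV \<subseteq> (\<Union>q\<in>F n. ball q (1 / real (Suc n)))"
    by metis
  define \<B> where "\<B> = (\<Union>n. (\<lambda>q. ball q (1 / real (Suc n))) ` F n)"
  have cnt: "countable \<B>"
    unfolding \<B>_def by (intro countable_UN countableI_type countable_finite finite_imageI F(1))
  have ne: "\<B> \<noteq> {}"
  proof -
    have "F 0 \<noteq> {}"
      using F(2)[of 0] by auto
    then show ?thesis
      unfolding \<B>_def by auto
  qed
  show ?thesis
  proof
    show "open (from_nat_into \<B> i)" for i
      using from_nat_into[OF ne, of i] by (auto simp: \<B>_def)
  next
    fix e :: real assume "0 < e"
    then obtain n where n: "1 / real (Suc n) < e / 2"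
      using nat_approx_posE half_gt_zero by blast
    define N where "N = Suc (Max ((\<lambda>q. to_nat_on \<B> (ball q (1 / real (Suc n)))) ` F n))"
    have "dist x y < e" if xy: "\<forall>i<N. x \<in> from_nat_into \<B> i \<longleftrightarrow> y \<in> from_nat_into \<B> i" for x y
    proof -
      obtain q where q: "q \<in> F n" "x \<in> ball q (1 / real (Suc n))"
        using F(2)[of n] by blast
      define i where "i = to_nat_on \<B> (ball q (1 / real (Suc n)))"
      have "i < N"
        unfolding N_def i_def less_Suc_eq_le using F(1) q(1) by (intro Max_ge) auto
      moreover have "from_nat_into \<B> i = ball q (1 / real (Suc n))"
        unfolding i_def using q(1) by (intro from_nat_into_to_nat_on cnt) (auto simp: \<B>_def)
      ultimately have "y \<in> ball q (1 / real (Suc n))"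
        using xy q(2) by auto
      then show ?thesis
        using q(2) n dist_triangle_half_l[of x q e y] by (auto simp: dist_commute)
    qed
    then show "\<exists>N. \<forall>x y. (\<forall>i<N. x \<in> from_nat_into \<B> i \<longleftrightarrow> y \<in> from_nat_into \<B> i) \<longrightarrow> dist x y < e"
      by blast
  qed
qed

text \<open>The code reads the memberships \<open>x \<in> B i\<close> as ternary digits. It is only
  Borel, but its inverse is uniformly continuous: close codes have the same first digits, hence come
  from close points. This is enough to transport weak limits back from the real line.\<close>

lemma compact_borel_code:
  assumes "compact (UNIV :: 'a::metric_space set)"
  obtains h :: "'a::metric_space \<Rightarrow> real" where "h \<in> borel_measurable borel" "range h \<subseteq> {0..2}"
    "\<And>e. 0 < e \<Longrightarrow> \<exists>\<eta>>0. \<forall>x y. \<bar>h x - h y\<bar> < \<eta> \<longrightarrow> dist x y < e"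
proof -
  obtain B :: "nat \<Rightarrow> 'a::metric_space set" where B: "\<And>i. open (B i)"
    "\<And>e. 0 < e \<Longrightarrow> \<exists>N. \<forall>x y. (\<forall>i<N. x \<in> B i \<longleftrightarrow> y \<in> B i) \<longrightarrow> dist x y < e"
    using compact_separating_sequence[OF assms] by blast
  define h where "h x = (\<Sum>i. of_bool (x \<in> B i) / 3 ^ i :: real)" for x
  have geo: "(\<lambda>j. 1 / 3 ^ j :: real) sums (3/2)"
    using geometric_sums[of "1/3::real"] by (simp add: power_divide)
  have sm: "summable (\<lambda>j. of_bool (w j) / 3 ^ j :: real)" for w :: "nat \<Rightarrow> bool"
    by (rule summable_comparison_test'[OF sums_summable[OF geo]]) (auto simp: divide_right_mono)
  show ?thesis
  proof
    have "(\<lambda>x. \<Sum>i. indicator (B i) x / 3 ^ i :: real) \<in> borel_measurable borel"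
      by (intro borel_measurable_suminf borel_measurable_divide borel_measurable_indicator borel_measurable_const borel_open B(1))
    moreover have "h = (\<lambda>x. \<Sum>i. indicator (B i) x / 3 ^ i)"
      unfolding h_def indicator_def ..
    ultimately show "h \<in> borel_measurable borel"
      by simp
    have "0 \<le> h x" for x
      unfolding h_def by (intro suminf_nonneg sm) auto
    moreover have "h x \<le> (\<Sum>i. 1 / 3 ^ i)" for x
      unfolding h_def by (intro suminf_le sm sums_summable[OF geo]) (auto simp: divide_right_mono)
    then have "h x \<le> 2" for x
      using order_trans[of "h x" "3/2" 2] sums_unique[OF geo] by simp
    ultimately show "range h \<subseteq> {0..2}"
      by auto
  next
    fix e :: real assume "0 < e"
    then obtain N where N: "\<And>x y. (\<forall>i<N. x \<in> B i \<longleftrightarrow> y \<in> B i) \<Longrightarrow> dist x y < e"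
      using B(2) by blast
    have "dist x y < e" if "\<bar>h x - h y\<bar> < 1 / (2 * 3 ^ N)" for x y
      using ternary_code_separates[of N "\<lambda>i. x \<in> B i" "\<lambda>i. y \<in> B i"] that N[of x y]
      unfolding h_def by fastforce
    then show "\<exists>\<eta>>0. \<forall>x y. \<bar>h x - h y\<bar> < \<eta> \<longrightarrow> dist x y < e"
      by (intro exI[of _ "1 / (2 * 3 ^ N)"]) auto
  qed
qed


text \<open>The images of the measures under the code are carried by a fixed bounded interval, so
  they are tight and a subsequence converges weakly on the line. The decoding map extends
  continuously to the closure \<open>C\<close> of the codes, the limit is carried by
  \<open>C\<close>, and its image under decoding is the desired \<open>N\<close>.\<close>

theorem compact_weak_convergent_subsequence:
  fixes \<nu> :: "nat \<Rightarrow> 'a::metric_space measure"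
  assumes cpt: "compact (UNIV :: 'a set)"
    and prob: "\<And>n. prob_space (\<nu> n)" and sets: "\<And>n. sets (\<nu> n) = sets borel"
  obtains r N where "strict_mono (r :: nat \<Rightarrow> nat)" "prob_space N" "sets N = sets borel"
    "\<And>f :: 'a \<Rightarrow> real. continuous_on UNIV f \<Longrightarrow> (\<lambda>k. \<integral>x. f x \<partial>\<nu> (r k)) \<longlonglongrightarrow> (\<integral>x. f x \<partial>N)"
proof -
  obtain h :: "'a \<Rightarrow> real" where h: "h \<in> borel_measurable borel" "range h \<subseteq> {0..2}"
    "\<And>e. 0 < e \<Longrightarrow> \<exists>\<eta>>0. \<forall>x y. \<bar>h x - h y\<bar> < \<eta> \<longrightarrow> dist x y < e"
    using compact_borel_code[OF cpt] by blast
  note [measurable_cong] = sets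
  have hm [measurable]: "h \<in> \<nu> n \<rightarrow>\<^sub>M borel" for n
    using h(1) measurable_cong_sets[OF sets refl] by blast
  define C where "C = closure (range h)"
  have C: "closed C" "h x \<in> C" for x
    using closure_subset[of "range h"] by (auto simp: C_def)
  \<comment> \<open>A point of the closure is a limit of codes; compactness lets the coded points
    themselves be chosen convergent, and their limit serves as the decoded value.\<close>
  have "\<exists>p. \<exists>s. (\<lambda>k. h (s k)) \<longlonglongrightarrow> c \<and> s \<longlonglongrightarrow> p" if c: "c \<in> C" for c
  proof -
    obtain u where u: "\<forall>k. u k \<in> range h" "u \<longlonglongrightarrow> c"
      using c unfolding C_def closure_sequential by auto
    define s where "s k = inv_into UNIV h (u k)" for k
    have s: "u k = h (s k)" for k
      unfolding s_def using u(1) by (simp add: f_inv_into_f)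
    obtain p q where "strict_mono q" "(s \<circ> q) \<longlonglongrightarrow> p"
      using compact_imp_seq_compact[OF cpt] unfolding seq_compact_def by (metis UNIV_I)
    moreover from this have "(u \<circ> q) \<longlonglongrightarrow> c"
      using u(2) by (intro LIMSEQ_subseq_LIMSEQ)
    ultimately show ?thesis
      using s by (auto simp: o_def intro!: exI[of _ p] exI[of _ "\<lambda>k. s (q k)"])
  qed
  then obtain g s where g: "\<And>c. c \<in> C \<Longrightarrow> (\<lambda>k. h (s c k)) \<longlonglongrightarrow> c" "\<And>c. c \<in> C \<Longrightarrow> s c \<longlonglongrightarrow> g c"
    by metis
  have cont_g: "continuous_on C g"
    unfolding continuous_on_iff
  proof (intro ballI allI impI)
    fix c and e :: real
    assume c: "c \<in> C" and "0 < e"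
    \<comment> \<open>Half of \<open>e\<close>, because a strict bound along the sequences only
      survives as a weak one in the limit.\<close>
    obtain \<eta> where \<eta>: "0 < \<eta>" "\<And>x y. \<bar>h x - h y\<bar> < \<eta> \<Longrightarrow> dist x y < e / 2"
      using h(3)[of "e / 2"] \<open>0 < e\<close> by auto
    have "dist (g d) (g c) < e" if d: "d \<in> C" "dist d c < \<eta>" for d
    proof -
      have "(\<lambda>k. \<bar>h (s d k) - h (s c k)\<bar>) \<longlonglongrightarrow> \<bar>d - c\<bar>"
        using g(1) c d(1) by (intro tendsto_intros)
      then have "\<forall>\<^sub>F k in sequentially. \<bar>h (s d k) - h (s c k)\<bar> < \<eta>"
        using d(2) by (intro order_tendstoD) (auto simp: dist_real_def)
      then have "\<forall>\<^sub>F k in sequentially. dist (s d k) (s c k) \<le> e / 2"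
        by eventually_elim (use \<eta>(2) in \<open>auto intro: less_imp_le\<close>)
      moreover have "(\<lambda>k. dist (s d k) (s c k)) \<longlonglongrightarrow> dist (g d) (g c)"
        using g(2) c d(1) by (intro tendsto_intros)
      ultimately have "dist (g d) (g c) \<le> e / 2"
        by (intro tendsto_upperbound[where F = sequentially]) auto
      then show ?thesis
        using \<open>0 < e\<close> by linarith
    qed
    then show "\<exists>\<eta>>0. \<forall>d\<in>C. dist d c < \<eta> \<longrightarrow> dist (g d) (g c) < e"
      using \<eta>(1) by blast
  qed
  have g_h: "g (h x) = x" for x
  proof -
    have "s (h x) \<longlonglongrightarrow> x"
      unfolding lim_sequentially
    proof (intro allI impI)
      fix e :: real assume "0 < e"
      then obtain \<eta> where \<eta>: "0 < \<eta>" "\<And>x y. \<bar>h x - h y\<bar> < \<eta> \<Longrightarrow> dist x y < e"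
        using h(3) by blast
      obtain n where "\<And>k. n \<le> k \<Longrightarrow> dist (h (s (h x) k)) (h x) < \<eta>"
        using g(1)[OF C(2)[of x]] \<eta>(1) unfolding lim_sequentially by blast
      then show "\<exists>n. \<forall>k\<ge>n. dist (s (h x) k) x < e"
        using \<eta>(2) unfolding dist_real_def by blast
    qed
    then show ?thesis
      using g(2)[OF C(2)] LIMSEQ_unique by blast
  qed
  have rd: "real_distribution (distr (\<nu> n) borel h)" for n
    unfolding real_distribution_def real_distribution_axioms_def
    using prob_space.prob_space_distr[OF prob hm] by simp
  have tight: "tight (\<lambda>n. distr (\<nu> n) borel h)"
    unfolding tight_def
  proof (intro conjI allI impI rd)
    fix e :: real assume "0 < e"
    \<comment> \<open>Tightness is stated with intervals open on the left and the code may equal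
      \<open>0\<close>, so the left end is moved to \<open>-1\<close>.\<close>
    have "measure (distr (\<nu> n) borel h) {-1<..2} = 1" for n
    proof -
      have "h x \<in> {-1<..2}" for x
        using range_subsetD[OF h(2), of x] by simp
      then have "h -` {-1<..2} \<inter> space (\<nu> n) = space (\<nu> n)"
        by auto
      then show ?thesis
        using prob_space.prob_space[OF prob] by (simp add: measure_distr)
    qed
    with \<open>0 < e\<close> show "\<exists>a b. a < b \<and> (\<forall>n. 1 - e < measure (distr (\<nu> n) borel h) {a<..b})"
      by (intro exI[of _ "-1"] exI[of _ 2]) auto
  qed
  obtain r M where r: "strict_mono (r :: nat \<Rightarrow> nat)" "real_distribution M"
    "weak_conv_m (\<lambda>k. distr (\<nu> (r k)) borel h) M"
    using tight_imp_convergent_subsubsequence[OF tight strict_mono_id] unfolding o_def id_apply by blast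
  interpret M: real_distribution M by fact
  have lim: "(\<lambda>k. \<integral>x. F (h x) \<partial>\<nu> (r k)) \<longlonglongrightarrow> (\<integral>t. F t \<partial>M)"
    if F: "continuous_on UNIV F" "\<And>t. norm (F t) \<le> B" for F :: "real \<Rightarrow> real" and B
  proof -
    have "(\<lambda>k. \<integral>t. F t \<partial>distr (\<nu> (r k)) borel h) \<longlonglongrightarrow> (\<integral>t. F t \<partial>M)"
      using F by (intro weak_conv_imp_integral_bdd_continuous_conv[OF rd r(2,3)])
        (auto simp: continuous_on_eq_continuous_at)
    moreover have [measurable]: "F \<in> borel_measurable borel"
      using F(1) by (rule borel_measurable_continuous_onI)
    ultimately show ?thesis
      by (simp add: integral_distr)
  qed
  \<comment> \<open>The truncated distance to \<open>C\<close> is a bounded continuous test function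
    that vanishes on every code, so its integral under the limit is \<open>0\<close>.\<close>
  have AE_C: "AE t in M. t \<in> C"
  proof -
    let ?F = "\<lambda>t. min 1 (infdist t C)"
    have "(\<lambda>k. \<integral>x. ?F (h x) \<partial>\<nu> (r k)) \<longlonglongrightarrow> (\<integral>t. ?F t \<partial>M)"
      by (rule lim[of ?F 1]) (auto intro!: continuous_intros simp: infdist_nonneg)
    moreover have "?F (h x) = 0" for x
      using C(2) by simp
    ultimately have "(\<integral>t. ?F t \<partial>M) = 0"
      by (simp add: LIMSEQ_const_iff)
    moreover have [measurable]: "?F \<in> borel_measurable borel"
      by (intro borel_measurable_continuous_onI continuous_intros)
    have "integrable M ?F"
      by (rule M.integrable_const_bound[where B = 1]) (auto simp: infdist_nonneg)
    ultimately have zero: "AE t in M. ?F t = 0"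
      by (subst (asm) integral_nonneg_eq_0_iff_AE) (auto simp: infdist_nonneg)
    have "C \<noteq> {}"
      using C(2) by blast
    then have "t \<in> C" if "?F t = 0" for t
      using that in_closed_iff_infdist_zero[OF C(1), of t] by (simp add: min_def split: if_splits)
    with zero show ?thesis
      by (rule eventually_mono)
  qed
  \<comment> \<open>A total Borel version of \<open>g\<close>; the value outside \<open>C\<close> is
    irrelevant because \<open>M\<close> does not charge the complement of \<open>C\<close>.\<close>
  define G where "G t = (if t \<in> C then g t else undefined)" for t
  have [measurable]: "G \<in> borel_measurable borel"
    unfolding G_def using C(1) cont_g by (intro borel_measurable_continuous_on_if) auto
  show ?thesis
  proof
    show "strict_mono r" by fact
    show "prob_space (distr M borel G)"
      by (rule M.prob_space_distr) simp
    show "sets (distr M borel G) = sets borel"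
      by simp
    fix f :: "'a \<Rightarrow> real" assume f: "continuous_on UNIV f"
    then have [measurable]: "f \<in> borel_measurable borel"
      by (rule borel_measurable_continuous_onI)
    obtain B where B: "0 < B" "\<And>x. norm (f x) \<le> B"
      using compact_imp_bounded[OF compact_continuous_image[OF f cpt]]
      unfolding bounded_pos by auto
    \<comment> \<open>Weak convergence can only be tested with functions on the whole line, so the
      decoded test function is extended from \<open>C\<close> by Tietze, keeping the bound
      \<open>B\<close>.\<close>
    have "continuous_on C (\<lambda>t. f (g t))"
      by (rule continuous_on_compose2[OF f cont_g]) auto
    then obtain F where F: "continuous_on UNIV F" "\<And>t. t \<in> C \<Longrightarrow> F t = f (g t)" "\<And>t. norm (F t) \<le> B"
      using Tietze[of C "\<lambda>t. f (g t)" UNIV B] C(1) B by (metis UNIV_I closed_closedin less_imp_le subtopology_UNIV)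
    have [measurable]: "F \<in> borel_measurable borel"
      using F(1) by (rule borel_measurable_continuous_onI)
    have "(\<integral>x. f x \<partial>distr M borel G) = (\<integral>t. f (G t) \<partial>M)"
      by (simp add: integral_distr)
    also have "\<dots> = (\<integral>t. F t \<partial>M)"
    proof (rule integral_cong_AE)
      show "AE t in M. f (G t) = F t"
        using AE_C by eventually_elim (simp add: G_def F(2))
    qed measurable
    finally show "(\<lambda>k. \<integral>x. f x \<partial>\<nu> (r k)) \<longlonglongrightarrow> (\<integral>x. f x \<partial>distr M borel G)"
      using lim[OF F(1,3)] F(2)[OF C(2)] g_h by simp
  qed
qed

subsection \<open>Hoelder test functions and total variation\<close>

text \<open>Only differences are constrained, so the class ignores additive constants. Constants are
  fixed by the transition operator, so the oscillation \<open>a\<close>, and not the sup norm, is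
  what can contract.\<close>

definition hoelder_class :: "real \<Rightarrow> real \<Rightarrow> real \<Rightarrow> ('a::metric_space \<Rightarrow> real) set" where
  "hoelder_class \<alpha> a b = {f. \<forall>x y. \<bar>f x - f y\<bar> \<le> a \<and> \<bar>f x - f y\<bar> \<le> b * dist x y powr \<alpha>}"

lemma hoelder_class_continuous:
  assumes "0 < \<alpha>" "f \<in> hoelder_class \<alpha> a b"
  shows "continuous_on UNIV f"
proof -
  have "(f \<longlongrightarrow> f x) (at x)" for x
  proof -
    have "((\<lambda>y. b * dist y x powr \<alpha>) \<longlongrightarrow> b * dist x x powr \<alpha>) (at x)"
      using assms(1) by (intro tendsto_intros) auto
    then have "((\<lambda>y. f y - f x) \<longlongrightarrow> 0) (at x)"
      by (intro Lim_null_comparison[of "\<lambda>y. f y - f x"]) (use assms(2) in \<open>auto simp: hoelder_class_def\<close>)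
    then show ?thesis
      by (simp add: LIM_zero_cancel)
  qed
  then show ?thesis
    by (simp add: continuous_on)
qed

lemma hoelder_class_measurable:
  assumes "0 < \<alpha>" "f \<in> hoelder_class \<alpha> a b"
  shows "f \<in> borel_measurable borel"
  using hoelder_class_continuous[OF assms] by (rule borel_measurable_continuous_onI)

text \<open>Turns a Lipschitz function with values in the unit interval into a Hoelder
  function.\<close>

lemma min_one_le_powr:
  fixes t \<alpha> :: real
  assumes "0 \<le> t" "0 < \<alpha>" "\<alpha> \<le> 1"
  shows "min 1 t \<le> t powr \<alpha>"
proof (cases "t \<le> 1")
  case True
  then show ?thesis
    using powr_mono'[of \<alpha> 1 t] assms by (cases "t = 0") auto
next
  case False
  then show ?thesis
    using ge_one_powr_ge_zero[of t \<alpha>] assms by auto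
qed

text \<open>The functions \<open>max 0 (1 - k * infdist x A)\<close> decrease to the indicator
  because \<open>A\<close> is closed. Their Hoelder constants grow with \<open>k\<close>, which is
  harmless since each function is used on its own before the limit is taken.\<close>

lemma closed_indicator_limit_hoelder:
  fixes A :: "'a::metric_space set"
  assumes "closed A" "0 < \<alpha>" "\<alpha> \<le> 1"
  obtains f :: "nat \<Rightarrow> 'a \<Rightarrow> real" and b :: "nat \<Rightarrow> real"
  where "\<And>k. f k \<in> hoelder_class \<alpha> 1 (b k)"
    "\<And>k x. 0 \<le> f k x" "\<And>k x. f k x \<le> 1" "\<And>x. (\<lambda>k. f k x) \<longlonglongrightarrow> indicator A x"
proof (cases "A = {}")
  \<comment> \<open>\<open>infdist x {}\<close> is \<open>0\<close> by convention, so the general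
    formula would give the constant \<open>1\<close> here.\<close>
  case True
  then show ?thesis
    by (intro that[of "\<lambda>_ _. 0" "\<lambda>_. 0"]) (auto simp: hoelder_class_def)
next
  case False
  define f where "f k x = max 0 (1 - real k * infdist x A)" for k x
  have f01: "0 \<le> f k x" "f k x \<le> 1" for k x
    unfolding f_def by (auto simp: infdist_nonneg)
  show ?thesis
  proof (rule that[of f "\<lambda>k. real k powr \<alpha>"])
    have "\<bar>f k x - f k y\<bar> \<le> real k powr \<alpha> * dist x y powr \<alpha>" for k x y
    proof -
      have "\<bar>f k x - f k y\<bar> \<le> \<bar>real k * infdist x A - real k * infdist y A\<bar>"
        unfolding f_def by linarith
      also have "\<dots> = real k * \<bar>infdist x A - infdist y A\<bar>"
        by (simp add: abs_mult flip: right_diff_distrib)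
      also have "\<dots> \<le> real k * dist x y"
        by (intro mult_left_mono infdist_triangle_abs) auto
      finally have "\<bar>f k x - f k y\<bar> \<le> min 1 (real k * dist x y)"
        using f01[of k x] f01[of k y] by linarith
      also have "\<dots> \<le> (real k * dist x y) powr \<alpha>"
        using assms(2,3) by (intro min_one_le_powr) auto
      finally show ?thesis
        by (simp add: powr_mult)
    qed
    moreover have "\<bar>f k x - f k y\<bar> \<le> 1" for k x y
      using f01[of k x] f01[of k y] by linarith
    ultimately show "f k \<in> hoelder_class \<alpha> 1 (real k powr \<alpha>)" for k
      by (auto simp: hoelder_class_def)
  next
    show "(\<lambda>k. f k x) \<longlonglongrightarrow> indicator A x" for x
    proof (cases "x \<in> A")
      case False
      then have pos: "0 < infdist x A"
        using infdist_pos_not_in_closed[OF assms(1) \<open>A \<noteq> {}\<close>] by blast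
      obtain n where n: "1 / infdist x A \<le> real n"
        using real_arch_simple by blast
      have "f k x = 0" if "n \<le> k" for k
      proof -
        have "1 \<le> real n * infdist x A"
          using n pos by (simp add: field_simps)
        also have "\<dots> \<le> real k * infdist x A"
          using that pos by (intro mult_right_mono) auto
        finally show ?thesis
          by (simp add: f_def)
      qed
      then have "(\<lambda>k. f k x) \<longlonglongrightarrow> 0"
        by (intro tendsto_eventually eventually_sequentiallyI)
      then show ?thesis
        using False by simp
    qed (simp add: f_def)
  qed (use f01 in auto)
qed

lemma integral_limit_indicator:
  assumes M: "prob_space M" "A \<in> sets M" and f: "\<And>k. f k \<in> borel_measurable M"
    "\<And>k x. 0 \<le> f k x" "\<And>k x. f k x \<le> (1::real)" "\<And>x. (\<lambda>k. f k x) \<longlonglongrightarrow> indicator A x"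
  shows "(\<lambda>k. \<integral>x. f k x \<partial>M) \<longlonglongrightarrow> measure M A"
proof -
  interpret prob_space M by fact
  have "(\<lambda>k. \<integral>x. f k x \<partial>M) \<longlonglongrightarrow> (\<integral>x. indicator A x \<partial>M)"
    by (rule integral_dominated_convergence[where w = "\<lambda>_. 1"]) (use M(2) f in auto)
  then show ?thesis
    using M(2) sets.sets_into_space by (simp add: Int_absorb2)
qed

text \<open>Closed sets are an intersection-stable generator of the Borel sets, and the measure of a
  closed set is a limit of integrals of Hoelder functions.\<close>

lemma prob_measure_eqI_hoelder:
  fixes M N :: "'a::metric_space measure"
  assumes M: "prob_space M" "sets M = sets borel" and N: "prob_space N" "sets N = sets borel"
    and \<alpha>: "0 < \<alpha>" "\<alpha> \<le> 1"
    and eq: "\<And>f b. f \<in> hoelder_class \<alpha> 1 b \<Longrightarrow> (\<integral>x. f x \<partial>M) = (\<integral>x. f x \<partial>N)"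
  shows "M = N"
proof (rule measure_eqI_generator_eq[where E = "Collect closed" and \<Omega> = UNIV and A = "\<lambda>_. UNIV"])
  show "Int_stable (Collect closed :: 'a set set)"
    by (auto simp: Int_stable_def)
  show "sets M = sigma_sets UNIV (Collect closed)" "sets N = sigma_sets UNIV (Collect closed)"
    using M(2) N(2) by (simp_all add: borel_eq_closed)
  show "emeasure M UNIV \<noteq> \<infinity>"
    using M(1) by (simp add: finite_measure.emeasure_eq_measure prob_space.finite_measure)
  fix A :: "'a set" assume "A \<in> Collect closed"
  then have "closed A"
    by simp
  show "emeasure M A = emeasure N A"
  proof (rule closed_indicator_limit_hoelder[OF \<open>closed A\<close> \<alpha>])
    fix f :: "nat \<Rightarrow> 'a \<Rightarrow> real" and b
    assume f: "\<And>k. f k \<in> hoelder_class \<alpha> 1 (b k)" "\<And>k x. 0 \<le> f k x" "\<And>k x. f k x \<le> 1"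
      "\<And>x. (\<lambda>k. f k x) \<longlonglongrightarrow> indicator A x"
    have meas: "f k \<in> borel_measurable M" "f k \<in> borel_measurable N" for k
      using hoelder_class_measurable[OF \<alpha>(1) f(1)[of k]] M(2) N(2) measurable_cong_sets by blast+
    have A: "A \<in> sets M" "A \<in> sets N"
      using \<open>closed A\<close> M(2) N(2) by auto
    have "(\<lambda>k. \<integral>x. f k x \<partial>M) \<longlonglongrightarrow> measure M A" "(\<lambda>k. \<integral>x. f k x \<partial>N) \<longlonglongrightarrow> measure N A"
      using f by (auto intro!: integral_limit_indicator M(1) N(1) A meas)
    then have "measure M A = measure N A"
      using eq[OF f(1)] LIMSEQ_unique by simp
    then show "emeasure M A = emeasure N A"
      using M(1) N(1) by (simp add: finite_measure.emeasure_eq_measure prob_space.finite_measure)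
  qed
qed auto

section \<open>Integrals against two measures that are close in total variation\<close>

text \<open>Round \<open>g\<close> down to multiples of \<open>1 / n\<close>. The level sets form a
  finite partition, to which the definition of \<open>tv_norm\<close> applies, and the weights
  \<open>j / n\<close> are at most \<open>1\<close>. Rounding costs \<open>1 / n\<close> for each of
  the two measures and vanishes as \<open>n\<close> grows.\<close>

lemma tv_norm_integral_unit:
  fixes g :: "'b \<Rightarrow> real"
  assumes M: "prob_space M" and N: "prob_space N" and sets: "sets N = sets M"
    and tv: "tv_norm M N \<le> ennreal t" and t: "0 \<le> t"
    and g: "g \<in> borel_measurable M" "\<And>x. 0 \<le> g x" "\<And>x. g x \<le> 1"
  shows "\<bar>(\<integral>x. g x \<partial>M) - (\<integral>x. g x \<partial>N)\<bar> \<le> t"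
proof -
  interpret M: prob_space M by fact
  interpret N: prob_space N by fact
  note [measurable] = g(1)
  have gN [measurable]: "g \<in> borel_measurable N"
    using g(1) measurable_cong_sets[OF sets refl] by blast
  have space: "space N = space M"
    using sets by (rule sets_eq_imp_space_eq)
  have "\<bar>(\<integral>x. g x \<partial>M) - (\<integral>x. g x \<partial>N)\<bar> \<le> t + 2 * inverse (real (Suc k))" for k
  proof -
    define n where "n = Suc k"
    have n: "0 < real n"
      by (simp add: n_def)
    define A where "A j = {x \<in> space M. \<lfloor>real n * g x\<rfloor> = int j}" for j
    have A [measurable]: "A j \<in> sets M" for j
      unfolding A_def by measurable
    then have AN [measurable]: "A j \<in> sets N" for j
      using sets by simp
    \<comment> \<open>The index runs up to \<open>n\<close> inclusive: the level \<open>n\<close> is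
      attained where \<open>g x = 1\<close>.\<close>
    define s where "s x = (\<Sum>j\<le>n. real j / real n * indicator (A j) x)" for x
    have s: "s x = of_int \<lfloor>real n * g x\<rfloor> / real n" if "x \<in> space M" for x
    proof -
      define j where "j = nat \<lfloor>real n * g x\<rfloor>"
      have j: "int j = \<lfloor>real n * g x\<rfloor>"
        using g(2)[of x] n by (simp add: j_def)
      have "real n * g x \<le> real n"
        using g(3)[of x] n by simp
      then have "j \<le> n"
        using j by linarith
      have "indicator (A i) x = (of_bool (i = j) :: real)" for i
        using that j by (auto simp: A_def indicator_def)
      then have "s x = (\<Sum>i\<le>n. if i = j then real i / real n else 0)"
        unfolding s_def by (intro sum.cong) auto
      also have "\<dots> = real j / real n"
        using \<open>j \<le> n\<close> by simp
      finally have "s x = real j / real n" .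
      then show ?thesis
        by (metis j of_int_of_nat_eq)
    qed
    have close: "s x \<le> g x \<and> g x \<le> s x + 1 / real n" if "x \<in> space M" for x
    proof -
      have "of_int \<lfloor>real n * g x\<rfloor> \<le> real n * g x" "real n * g x \<le> of_int \<lfloor>real n * g x\<rfloor> + 1"
        by linarith+
      then show ?thesis
        unfolding s[OF that] using n by (simp add: field_simps)
    qed
    have approx: "\<bar>(\<integral>x. g x \<partial>Q) - (\<Sum>j\<le>n. real j / real n * measure Q (A j))\<bar> \<le> 1 / real n"
      if Q: "prob_space Q" "sets Q = sets M" for Q
    proof -
      interpret Q: prob_space Q by fact
      have sp: "space Q = space M"
        using Q(2) by (rule sets_eq_imp_space_eq)
      have [measurable]: "g \<in> borel_measurable Q" "A j \<in> sets Q" for j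
        using g(1) measurable_cong_sets[OF Q(2) refl] A Q(2) by auto
      have int: "integrable Q g"
        by (rule Q.integrable_const_bound[where B = 1]) (use g in auto)
      have ind: "integrable Q (\<lambda>x. real j / real n * indicator (A j) x)" for j
        by (rule Q.integrable_const_bound[where B = "real j / real n"])
          (auto simp: indicator_def)
      have ints: "integrable Q s"
        unfolding s_def by (intro Bochner_Integration.integrable_sum ind)
      have eq: "(\<integral>x. s x \<partial>Q) = (\<Sum>j\<le>n. real j / real n * measure Q (A j))"
        unfolding s_def by (subst Bochner_Integration.integral_sum) (use ind in auto)
      have "(\<integral>x. s x \<partial>Q) \<le> (\<integral>x. g x \<partial>Q)"
        by (rule integral_mono[OF ints int]) (use close sp in auto)
      moreover have "(\<integral>x. g x \<partial>Q) \<le> (\<integral>x. s x + 1 / real n \<partial>Q)"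
        by (rule integral_mono[OF int]) (use close sp ints in auto)
      then have "(\<integral>x. g x \<partial>Q) \<le> (\<integral>x. s x \<partial>Q) + 1 / real n"
        using ints by (simp add: Q.prob_space)
      ultimately show ?thesis
        unfolding eq by linarith
    qed
    have "(\<Sum>j\<le>n. \<bar>measure M (A j) - measure N (A j)\<bar>) \<le> t"
    proof -
      \<comment> \<open>A partition must not contain the empty set, and distinct indices must give
        distinct blocks, so empty level sets are dropped.\<close>
      define J where "J = {j \<in> {..n}. A j \<noteq> {}}"
      have fin: "finite J"
        by (simp add: J_def)
      have inj: "inj_on A J"
        by (auto simp: inj_on_def J_def A_def)
      have "(\<Union>j\<in>J. A j) = space M"
      proof -
        have "\<exists>j\<in>J. x \<in> A j" if "x \<in> space M" for x
        proof -
          define j where "j = nat \<lfloor>real n * g x\<rfloor>"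
          have j: "int j = \<lfloor>real n * g x\<rfloor>"
            using g(2)[of x] n by (simp add: j_def)
          have "real n * g x \<le> real n"
            using g(3)[of x] n by simp
          then have "j \<le> n"
            using j by linarith
          moreover have "x \<in> A j"
            using that j by (simp add: A_def)
          ultimately show ?thesis
            by (auto simp: J_def)
        qed
        then show ?thesis
          by (auto simp: A_def)
      qed
      then have "partition_on (space M) (A ` J)"
        by (intro partition_onI) (auto simp: J_def A_def disjnt_def)
      then have "(\<Sum>B\<in>A ` J. ennreal \<bar>measure M B - measure N B\<bar>) \<le> tv_norm M N"
        unfolding tv_norm_def using fin A by (intro SUP_upper) auto
      then have "ennreal (\<Sum>j\<in>J. \<bar>measure M (A j) - measure N (A j)\<bar>) \<le> ennreal t"
        using tv by (simp add: sum.reindex[OF inj] sum_ennreal)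
      then have "(\<Sum>j\<in>J. \<bar>measure M (A j) - measure N (A j)\<bar>) \<le> t"
        using t by (simp add: ennreal_le_iff)
      moreover have "(\<Sum>j\<in>J. \<bar>measure M (A j) - measure N (A j)\<bar>)
          = (\<Sum>j\<le>n. \<bar>measure M (A j) - measure N (A j)\<bar>)"
        by (rule sum.mono_neutral_left) (auto simp: J_def)
      ultimately show ?thesis
        by simp
    qed
    moreover have "\<bar>(\<Sum>j\<le>n. real j / real n * measure M (A j)) - (\<Sum>j\<le>n. real j / real n * measure N (A j))\<bar>
        \<le> (\<Sum>j\<le>n. \<bar>measure M (A j) - measure N (A j)\<bar>)"
      unfolding sum_subtractf[symmetric] right_diff_distrib[symmetric]
    proof (intro sum_abs[THEN order_trans] sum_mono)
      fix j assume "j \<in> {..n}"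
      then have "real j / real n \<le> 1"
        using n by simp
      then show "\<bar>real j / real n * (measure M (A j) - measure N (A j))\<bar> \<le> \<bar>measure M (A j) - measure N (A j)\<bar>"
        unfolding abs_mult by (intro mult_left_le_one_le) auto
    qed
    ultimately show ?thesis
      using approx[OF M refl] approx[OF N sets] unfolding n_def inverse_eq_divide by linarith
  qed
  moreover have "(\<lambda>k. t + 2 * inverse (real (Suc k))) \<longlonglongrightarrow> t + 2 * 0"
    by (intro tendsto_intros LIMSEQ_inverse_real_of_nat)
  ultimately show ?thesis
    using LIMSEQ_le_const by fastforce
qed

text \<open>Rescale \<open>g\<close> affinely to the unit interval. The constant \<open>c\<close>
  cancels since both measures have mass one, which leaves the oscillation \<open>a\<close> as the
  factor.\<close>

lemma tv_norm_integral:
  fixes g :: "'b \<Rightarrow> real"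
  assumes M: "prob_space M" and N: "prob_space N" and sets: "sets N = sets M"
    and tv: "tv_norm M N \<le> ennreal t" and t: "0 \<le> t"
    and g: "g \<in> borel_measurable M" "\<And>x. c \<le> g x" "\<And>x. g x \<le> c + a"
  shows "\<bar>(\<integral>x. g x \<partial>M) - (\<integral>x. g x \<partial>N)\<bar> \<le> a * t"
proof (cases "a = 0")
  case True
  then have "g x = c" for x
    using g(2,3)[of x] by simp
  then show ?thesis
    using M N True by (simp add: prob_space.prob_space)
next
  case False
  then have a: "0 < a"
    using g(2)[of undefined] g(3)[of undefined] by linarith
  interpret M: prob_space M by fact
  interpret N: prob_space N by fact
  define h where "h x = (g x - c) / a" for x
  have h: "h \<in> borel_measurable M" "\<And>x. 0 \<le> h x" "\<And>x. h x \<le> 1"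
    using g a unfolding h_def by (auto simp: field_simps)
  have hN: "h \<in> borel_measurable N"
    using h(1) measurable_cong_sets[OF sets refl] by blast
  have int: "integrable M h" "integrable N h"
    using h hN by (auto intro!: M.integrable_const_bound[where B = 1] N.integrable_const_bound[where B = 1])
  have "g = (\<lambda>x. a * h x + c)"
    using a by (auto simp: h_def)
  then have "(\<integral>x. g x \<partial>M) - (\<integral>x. g x \<partial>N) = a * ((\<integral>x. h x \<partial>M) - (\<integral>x. h x \<partial>N))"
    using int by (simp add: M.prob_space N.prob_space right_diff_distrib)
  then show ?thesis
    using tv_norm_integral_unit[OF M N sets tv t h] a by (simp add: abs_mult)
qed

subsection \<open>The Lasota--Yorke inequality and merging of trajectories\<close>

lemma continuous_on_eval_bcontfun: "continuous_on UNIV (\<lambda>T :: 'a::metric_space \<Rightarrow>\<^sub>C 'b::metric_space. apply_bcontfun T x)"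
  unfolding continuous_on_iff using dist_fun_lt_imp_dist_val_lt by blast

lemma prob_on_Lip_measurable_eval:
  assumes "prob_on_Lip m"
  shows "(\<lambda>T. apply_bcontfun T x) \<in> m \<rightarrow>\<^sub>M borel"
proof -
  have "(\<lambda>T :: 'a \<Rightarrow>\<^sub>C 'a. apply_bcontfun T x) \<in> restrict_space borel Lip_maps \<rightarrow>\<^sub>M borel"
    by (intro measurable_restrict_space1 borel_measurable_continuous_onI continuous_on_eval_bcontfun)
  moreover have "sets m = sets (restrict_space borel Lip_maps)"
    using assms unfolding prob_on_Lip_def by simp
  ultimately show ?thesis
    by (subst measurable_cong_sets[OF _ refl])
qed

text \<open>The whole distance is continuous in \<open>T\<close>. Arguing this way avoids
  measurability on a product, since the type \<open>'a\<close> is not assumed second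
  countable.\<close>

lemma prob_on_Lip_measurable_dist:
  assumes "prob_on_Lip m"
  shows "(\<lambda>T. dist (apply_bcontfun T x) (apply_bcontfun T y)) \<in> borel_measurable m"
proof -
  have "(\<lambda>T :: 'a \<Rightarrow>\<^sub>C 'a. dist (apply_bcontfun T x) (apply_bcontfun T y)) \<in> borel_measurable (restrict_space borel Lip_maps)"
    by (intro measurable_restrict_space1 borel_measurable_continuous_onI continuous_on_dist
        continuous_on_eval_bcontfun)
  moreover have "sets m = sets (restrict_space borel Lip_maps)"
    using assms unfolding prob_on_Lip_def by simp
  ultimately show ?thesis
    by (subst measurable_cong_sets[OF _ refl])
qed

lemma hoelder_class_range:
  assumes "f \<in> hoelder_class \<alpha> a b"
  obtains c where "\<And>x. c \<le> f x" "\<And>x. f x \<le> c + a"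
proof
  have le: "f x - a \<le> f y" for x y
    using assms by (auto simp: hoelder_class_def abs_le_iff algebra_simps)
  have bdd: "bdd_below (range f)"
    using le[of undefined] by (intro bdd_belowI2[where m = "f undefined - a"]) auto
  show "(INF x. f x) \<le> f x" for x
    by (rule cINF_lower[OF bdd]) simp
  show "f x \<le> (INF x. f x) + a" for x
    using cINF_greatest[of UNIV "f x - a" f] le by simp
qed

lemma hoelder_class_mono:
  "f \<in> hoelder_class \<alpha> a b \<Longrightarrow> a \<le> a' \<Longrightarrow> b \<le> b' \<Longrightarrow> f \<in> hoelder_class \<alpha> a' b'"
  unfolding hoelder_class_def
  by (clarsimp; meson mult_right_mono order_trans powr_ge_zero)

lemma hoelder_class_scale:
  assumes "f \<in> hoelder_class \<alpha> a b" "0 \<le> c"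
  shows "(\<lambda>x. c * f x) \<in> hoelder_class \<alpha> (c * a) (c * b)"
proof -
  have "\<bar>c * f x - c * f y\<bar> = c * \<bar>f x - f y\<bar>" for x y
    unfolding right_diff_distrib[symmetric] using assms(2) by (simp add: abs_mult)
  then show ?thesis
    using assms by (auto simp: hoelder_class_def mult.assoc intro: mult_left_mono)
qed

lemma hoelder_class_nonneg: "f \<in> hoelder_class \<alpha> a b \<Longrightarrow> 0 \<le> a"
  unfolding hoelder_class_def by force

section \<open>Regularity of the transition operator on Hoelder functions\<close>

text \<open>The contraction and total variation hypotheses appear with denominators cleared, so that
  they cover \<open>x = y\<close> as well.\<close>

locale hoelder_chain =
  fixes \<mu> :: "'a::metric_space \<Rightarrow> ('a \<Rightarrow>\<^sub>C 'a) measure" and \<alpha> r R :: real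
  assumes prob_Lip: "\<And>x. prob_on_Lip (\<mu> x)"
    and alpha: "0 < \<alpha>" "\<alpha> \<le> 1" and r: "0 \<le> r" "r < 1" and R: "0 \<le> R"
    and contr: "\<And>x y. (\<integral>\<^sup>+T. ennreal (dist (apply_bcontfun T x) (apply_bcontfun T y) powr \<alpha>) \<partial>\<mu> x)
      \<le> ennreal (r * dist x y powr \<alpha>)"
    and tv: "\<And>x y. tv_norm (\<mu> x) (\<mu> y) \<le> ennreal (R * dist x y powr \<alpha>)"
begin

text \<open>The real counterpart of \<open>transition_op\<close>: the estimates use the order of the
  reals, and complex functions are split into real and imaginary parts only at the end.\<close>

definition P :: "('a \<Rightarrow> real) \<Rightarrow> 'a \<Rightarrow> real" where
  "P f x = (\<integral>T. f (apply_bcontfun T x) \<partial>\<mu> x)"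

lemma prob_space_mu: "prob_space (\<mu> x)"
  using prob_Lip[of x] by (simp add: prob_on_Lip_def)

lemma sets_mu: "sets (\<mu> x) = sets (\<mu> y)"
  using prob_Lip[of x] prob_Lip[of y] by (simp add: prob_on_Lip_def)

lemma eval_measurable [measurable]: "(\<lambda>T. apply_bcontfun T x) \<in> \<mu> y \<rightarrow>\<^sub>M borel"
  by (rule prob_on_Lip_measurable_eval[OF prob_Lip])

lemma integrable_eval:
  assumes "f \<in> hoelder_class \<alpha> a b"
  shows "integrable (\<mu> y) (\<lambda>T. f (apply_bcontfun T x))"
proof -
  obtain c where c: "\<And>x. c \<le> f x" "\<And>x. f x \<le> c + a"
    using hoelder_class_range[OF assms] by blast
  have "\<bar>f z\<bar> \<le> \<bar>c\<bar> + \<bar>a\<bar>" for z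
    using c[of z] by linarith
  then show ?thesis
    using hoelder_class_measurable[OF alpha(1) assms]
    by (intro finite_measure.integrable_const_bound[OF prob_space.finite_measure[OF prob_space_mu]]
        measurable_compose[OF eval_measurable]) auto
qed

lemma P_range:
  assumes "f \<in> hoelder_class \<alpha> a b" "\<And>x. c \<le> f x" "\<And>x. f x \<le> d"
  shows "c \<le> P f x" "P f x \<le> d"
  unfolding P_def using assms(2,3)
  by (auto intro!: prob_space.integral_ge_const[OF prob_space_mu] prob_space.integral_le_const[OF prob_space_mu]
      integrable_eval[OF assms(1)])

text \<open>Insert the integral of \<open>f (T y)\<close> against \<open>\<mu> x\<close>. The first
  difference compares two points under one measure and is bounded by contraction in mean, giving
  \<open>r * b\<close>; the second compares two measures at one point and is bounded by total
  variation, giving \<open>R * a\<close>.\<close>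

lemma P_hoelder_class:
  assumes f: "f \<in> hoelder_class \<alpha> a b" and b: "0 \<le> b"
  shows "P f \<in> hoelder_class \<alpha> a (r * b + R * a)"
proof -
  obtain c where c: "\<And>x. c \<le> f x" "\<And>x. f x \<le> c + a"
    using hoelder_class_range[OF f] by blast
  note int = integrable_eval[OF f]
  have "\<bar>P f x - P f y\<bar> \<le> a" for x y
    using P_range[OF f c, of x] P_range[OF f c, of y] by linarith
  moreover have "\<bar>P f x - P f y\<bar> \<le> (r * b + R * a) * dist x y powr \<alpha>" for x y
  proof -
    let ?D = "\<integral>T. f (apply_bcontfun T x) - f (apply_bcontfun T y) \<partial>\<mu> x"
    have "ennreal \<bar>?D\<bar> \<le> (\<integral>\<^sup>+T. ennreal \<bar>f (apply_bcontfun T x) - f (apply_bcontfun T y)\<bar> \<partial>\<mu> x)"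
      using integral_norm_bound_ennreal[OF Bochner_Integration.integrable_diff[OF int int]] by simp
    also have "\<dots> \<le> (\<integral>\<^sup>+T. ennreal b * ennreal (dist (apply_bcontfun T x) (apply_bcontfun T y) powr \<alpha>) \<partial>\<mu> x)"
      using f b by (intro nn_integral_mono) (auto simp: hoelder_class_def simp flip: ennreal_mult)
    also have "\<dots> = ennreal b * (\<integral>\<^sup>+T. ennreal (dist (apply_bcontfun T x) (apply_bcontfun T y) powr \<alpha>) \<partial>\<mu> x)"
      by (intro nn_integral_cmult measurable_compose[OF prob_on_Lip_measurable_dist[OF prob_Lip]]) measurable
    also have "\<dots> \<le> ennreal b * ennreal (r * dist x y powr \<alpha>)"
      by (intro mult_left_mono contr) auto
    finally have "\<bar>?D\<bar> \<le> b * (r * dist x y powr \<alpha>)"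
      using b r(1) by (simp add: ennreal_le_iff flip: ennreal_mult)
    moreover have "\<bar>(\<integral>T. f (apply_bcontfun T y) \<partial>\<mu> x) - (\<integral>T. f (apply_bcontfun T y) \<partial>\<mu> y)\<bar>
        \<le> a * (R * dist x y powr \<alpha>)"
      by (rule tv_norm_integral[OF prob_space_mu prob_space_mu sets_mu tv])
        (use R c hoelder_class_measurable[OF alpha(1) f] in
          \<open>auto intro: measurable_compose[OF eval_measurable]\<close>)
    moreover have "P f x - P f y
        = ?D + ((\<integral>T. f (apply_bcontfun T y) \<partial>\<mu> x) - (\<integral>T. f (apply_bcontfun T y) \<partial>\<mu> y))"
      unfolding P_def by (simp add: int)
    ultimately show ?thesis
      by (simp add: algebra_simps)
  qed
  ultimately show ?thesis
    by (auto simp: hoelder_class_def)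
qed

text \<open>\<open>R / (1 - r) * a\<close> is the fixed point of the affine recursion
  \<open>b \<mapsto> r * b + R * a\<close>; the initial Hoelder constant is forgotten at rate
  \<open>r\<close>.\<close>

lemma P_pow_hoelder_class:
  assumes f: "f \<in> hoelder_class \<alpha> a b" and b: "0 \<le> b"
  shows "(P ^^ n) f \<in> hoelder_class \<alpha> a (r ^ n * b + R / (1 - r) * a)"
proof (induction n)
  case 0
  show ?case
    using f R r hoelder_class_nonneg[OF f] by (auto intro: hoelder_class_mono)
next
  case (Suc n)
  have "r * (r ^ n * b + R / (1 - r) * a) + R * a = r ^ Suc n * b + R / (1 - r) * a"
    using r(2) by (simp add: field_simps)
  moreover have "0 \<le> r ^ n * b + R / (1 - r) * a"
    using b R r hoelder_class_nonneg[OF f] by simp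
  ultimately show ?case
    using P_hoelder_class[OF Suc] by simp
qed

lemma P_pow_scale: "(P ^^ n) (\<lambda>x. c * f x) = (\<lambda>x. c * (P ^^ n) f x)"
proof (induction n)
  case (Suc n)
  have "P (\<lambda>x. c * g x) = (\<lambda>x. c * P g x)" for g
    by (rule ext) (simp add: P_def)
  then show ?case
    using Suc by simp
qed simp

text \<open>The factor 2 makes the limiting Hoelder constant \<open>R / (1 - r)\<close> at most half
  of \<open>K\<close>; that slack is spent in \<open>eventual_contraction\<close>. The summand 1
  keeps \<open>K\<close> positive when \<open>R = 0\<close>.\<close>

definition K :: real where
  "K = 2 * (R / (1 - r)) + 1"

lemma K: "0 < K" "2 * (R / (1 - r)) \<le> K"
  using R r by (auto simp: K_def intro: add_nonneg_pos)

text \<open>Invariance of the class comes from \<open>r * K + R \<le> K\<close>, which is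
  \<open>R / (1 - r) \<le> K\<close> rearranged.\<close>

lemma P_hoelder_class_K:
  assumes "f \<in> hoelder_class \<alpha> 1 K"
  shows "(P ^^ n) f \<in> hoelder_class \<alpha> 1 K"
proof (induction n)
  case (Suc n)
  have "R / (1 - r) \<ge> 0"
    using R r by simp
  then have "R / (1 - r) * (1 - r) \<le> K * (1 - r)"
    using K r by (intro mult_right_mono) linarith+
  moreover have "R / (1 - r) * (1 - r) = R"
    using r by simp
  ultimately have "r * K + R * 1 \<le> K"
    by (simp add: algebra_simps)
  then show ?case
    using hoelder_class_mono[OF P_hoelder_class[OF Suc]] K by simp
qed (use assms in simp)

end

section \<open>Minorization and merging of pairs of points\<close>

locale minorized_hoelder_chain = hoelder_chain +
  fixes \<delta> :: real and m :: "('a \<Rightarrow>\<^sub>C 'a) measure"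
  assumes delta: "0 < \<delta>" and m_Lip: "prob_on_Lip m"
    and minor: "\<And>x A. A \<in> sets m \<Longrightarrow> ennreal \<delta> * emeasure m A \<le> emeasure (\<mu> x) A"
begin

sublocale m: prob_space m
  using m_Lip by (simp add: prob_on_Lip_def)

lemma sets_m: "sets m = sets (\<mu> x)"
  using m_Lip prob_Lip[of x] by (simp add: prob_on_Lip_def)

lemma eval_measurable_m [measurable]: "(\<lambda>T. apply_bcontfun T x) \<in> m \<rightarrow>\<^sub>M borel"
  by (rule prob_on_Lip_measurable_eval[OF m_Lip])

lemma integrable_eval_m:
  assumes "f \<in> hoelder_class \<alpha> a b"
  shows "integrable m (\<lambda>T. f (apply_bcontfun T x))"
proof -
  obtain c where c: "\<And>x. c \<le> f x" "\<And>x. f x \<le> c + a"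
    using hoelder_class_range[OF assms] by blast
  have "\<bar>f z\<bar> \<le> \<bar>c\<bar> + \<bar>a\<bar>" for z
    using c[of z] by linarith
  then show ?thesis
    using hoelder_class_measurable[OF alpha(1) assms]
    by (intro m.integrable_const_bound measurable_compose[OF eval_measurable_m]) auto
qed

text \<open>The setwise bound says that \<open>scale_measure \<delta> m\<close> lies below
  \<open>\<mu> x\<close> as a measure, and integrals of nonnegative functions are monotone in the
  measure.\<close>

lemma minor_integral:
  assumes g: "integrable m g" "integrable (\<mu> x) g" "\<And>T. 0 \<le> g T"
  shows "\<delta> * (\<integral>T. g T \<partial>m) \<le> (\<integral>T. g T \<partial>\<mu> x)"
proof -
  have "ennreal (\<delta> * (\<integral>T. g T \<partial>m)) = ennreal \<delta> * (\<integral>\<^sup>+T. ennreal (g T) \<partial>m)"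
    using delta g by (simp add: ennreal_mult integral_nonneg_AE nn_integral_eq_integral)
  also have "\<dots> = (\<integral>\<^sup>+T. ennreal (g T) \<partial>scale_measure (ennreal \<delta>) m)"
    using g(1) by (subst nn_integral_scale_measure) auto
  also have "\<dots> \<le> (\<integral>\<^sup>+T. ennreal (g T) \<partial>\<mu> x)"
    using minor sets_m by (intro nn_integral_mono_measure) (auto simp: le_measure)
  also have "\<dots> = ennreal (\<integral>T. g T \<partial>\<mu> x)"
    using g by (simp add: nn_integral_eq_integral)
  finally show ?thesis
    using g(3) by (simp add: ennreal_le_iff integral_nonneg_AE)
qed

text \<open>
  For \<open>c \<le> f \<le> c + 1\<close>, minorize the two nonnegative integrands \<open>c + 1 - f (T x)\<close> and \<open>f (T y) - c\<close>
  separately: this avoids the remainder measures \<open>\<mu>\<^sub>x - \<delta> m\<close>.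
\<close>

lemma P_diff_minorized:
  assumes f: "f \<in> hoelder_class \<alpha> 1 b"
  shows "P f x - P f y \<le> 1 - \<delta> * (\<integral>T. 1 - (f (apply_bcontfun T x) - f (apply_bcontfun T y)) \<partial>m)"
proof -
  obtain c where c: "\<And>x. c \<le> f x" "\<And>x. f x \<le> c + 1"
    using hoelder_class_range[OF f] by blast
  interpret X: prob_space "\<mu> x" by (rule prob_space_mu)
  interpret Y: prob_space "\<mu> y" by (rule prob_space_mu)
  note int = integrable_eval[OF f] integrable_eval_m[OF f]
  have "\<delta> * (\<integral>T. c + 1 - f (apply_bcontfun T x) \<partial>m) \<le> (\<integral>T. c + 1 - f (apply_bcontfun T x) \<partial>\<mu> x)"
    by (rule minor_integral) (use c int in auto)
  moreover have "\<delta> * (\<integral>T. f (apply_bcontfun T y) - c \<partial>m) \<le> (\<integral>T. f (apply_bcontfun T y) - c \<partial>\<mu> y)"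
    by (rule minor_integral) (use c int in auto)
  ultimately show ?thesis
    unfolding P_def using int by (simp add: X.prob_space Y.prob_space m.prob_space algebra_simps)
qed

text \<open>
  Merging is phrased through test functions rather than couplings; this keeps it open in \<open>(x, y)\<close>
  and lets it be pulled back along a single map of the support at a time.
\<close>

definition merging :: "nat \<Rightarrow> real \<Rightarrow> 'a \<Rightarrow> 'a \<Rightarrow> bool" where
  "merging n e x y \<longleftrightarrow> (\<forall>f \<in> hoelder_class \<alpha> 1 K. (P ^^ n) f x - (P ^^ n) f y \<le> 1 - e)"

text \<open>The additional steps are absorbed into the test function, whose class is stable under
  \<open>P\<close>. Pairs with different merging times can thus be brought to a common one.\<close>

lemma merging_mono:
  assumes "merging n e x y" "n \<le> n'" "e' \<le> e"
  shows "merging n' e' x y"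
  unfolding merging_def
proof
  fix f :: "'a \<Rightarrow> real" assume "f \<in> hoelder_class \<alpha> 1 K"
  then have "(P ^^ n) ((P ^^ (n' - n)) f) x - (P ^^ n) ((P ^^ (n' - n)) f) y \<le> 1 - e"
    using assms(1) P_hoelder_class_K unfolding merging_def by blast
  moreover have "(P ^^ n) ((P ^^ (n' - n)) f) = (P ^^ n') f"
    using funpow_add[of n "n' - n" P] assms(2) by simp
  ultimately show "(P ^^ n') f x - (P ^^ n') f y \<le> 1 - e'"
    using assms(3) by simp
qed

text \<open>All iterates of a test function share the Hoelder constant \<open>K\<close>, so the loss
  depends on the displacement of the two points but not on \<open>n\<close>.\<close>

lemma merging_perturb:
  assumes "merging n e x y"
  shows "merging n (e - K * (dist x x' powr \<alpha> + dist y y' powr \<alpha>)) x' y'"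
  unfolding merging_def
proof
  fix f :: "'a \<Rightarrow> real" assume f: "f \<in> hoelder_class \<alpha> 1 K"
  have "\<bar>(P ^^ n) f u - (P ^^ n) f v\<bar> \<le> K * dist u v powr \<alpha>" for u v
    using P_hoelder_class_K[OF f] by (auto simp: hoelder_class_def)
  from this[of x x'] this[of y y']
  show "(P ^^ n) f x' - (P ^^ n) f y' \<le> 1 - (e - K * (dist x x' powr \<alpha> + dist y y' powr \<alpha>))"
    using assms f unfolding merging_def abs_le_iff
    by (fastforce simp: distrib_left)
qed

text \<open>Solves \<open>K d\<^sup>\<alpha> = e / 4\<close> for \<open>d\<close>.\<close>

definition radius :: "real \<Rightarrow> real" where
  "radius e = (e / (4 * K)) powr (1 / \<alpha>)"

lemma radius_pos: "0 < e \<Longrightarrow> 0 < radius e"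
  using K by (simp add: radius_def)

lemma radius_bound:
  assumes "0 < e" "0 \<le> d" "d < radius e"
  shows "K * d powr \<alpha> \<le> e / 4"
proof -
  have "d powr \<alpha> \<le> radius e powr \<alpha>"
    using assms alpha by (intro powr_mono2) auto
  also have "\<dots> = e / (4 * K)"
    using assms(1) K alpha by (simp add: radius_def powr_powr)
  finally show ?thesis
    using K by (simp add: field_simps)
qed

text \<open>Moving either point costs at most \<open>e / 4\<close>, so half of the gain remains. The
  radius depends on \<open>e\<close> alone, which makes the same bound usable for displaced maps and
  for displaced points.\<close>

lemma merging_open:
  assumes "merging n e x y" "0 < e" "dist x x' < radius e" "dist y y' < radius e"
  shows "merging n (e / 2) x' y'"
proof (rule merging_mono[OF merging_perturb[OF assms(1)]])
  show "e / 2 \<le> e - K * (dist x x' powr \<alpha> + dist y y' powr \<alpha>)"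
    using radius_bound[OF assms(2) _ assms(3)] radius_bound[OF assms(2) _ assms(4)]
    by (simp add: distrib_left)
qed simp

text \<open>At such a distance the Hoelder bound alone limits the variation to
  \<open>e / 4 \<le> 1 / 2\<close>; the chain has not yet moved.\<close>

lemma merging_near:
  assumes "dist x y < radius e" "0 < e" "e \<le> 2"
  shows "merging 0 (1 / 2) x y"
  unfolding merging_def
proof
  fix f :: "'a \<Rightarrow> real" assume "f \<in> hoelder_class \<alpha> 1 K"
  then have "f x - f y \<le> K * dist x y powr \<alpha>"
    by (auto simp: hoelder_class_def abs_le_iff)
  then show "(P ^^ 0) f x - (P ^^ 0) f y \<le> 1 - 1 / 2"
    using radius_bound[of e "dist x y"] assms by simp
qed

text \<open>A ball around \<open>T\<close> has positive \<open>m\<close>-measure. Each map in it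
  sends \<open>(x, y)\<close> close to the good pair and keeps a gain of \<open>e / 2\<close>; any
  other map loses nothing, because the oscillation is at most \<open>1\<close>. Averaging over
  \<open>m\<close> and minorizing gives the gain
  \<open>\<delta> * (e / 2 * measure m B)\<close>.\<close>

lemma merging_support:
  assumes T: "T \<in> measure_support m" and e: "0 < e"
    and good: "merging n e (apply_bcontfun T x) (apply_bcontfun T y)"
  obtains e' where "0 < e'" "merging (Suc n) e' x y"
proof -
  define B where "B = ball T (radius e) \<inter> space m"
  have "emeasure m B > 0"
    using T radius_pos[OF e] unfolding measure_support_def B_def by auto
  then have p: "0 < measure m B"
    by (simp add: m.emeasure_eq_measure)
  \<comment> \<open>\<open>m\<close> lives on the trace of the Borel sets on
    \<open>Lip_maps\<close>, so the ball has to be cut down to that set.\<close>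
  have "ball T (radius e) \<inter> Lip_maps \<in> sets (restrict_space borel Lip_maps)"
    unfolding sets_restrict_space by (rule image_eqI[where x = "ball T (radius e)"]) auto
  moreover have "space m = Lip_maps"
    using m_Lip sets_eq_imp_space_eq[of m "restrict_space borel Lip_maps"]
    by (simp add: prob_on_Lip_def space_restrict_space)
  ultimately have B [measurable]: "B \<in> sets m"
    using m_Lip by (simp add: B_def prob_on_Lip_def)
  have "merging (Suc n) (\<delta> * (e / 2 * measure m B)) x y"
    unfolding merging_def
  proof
    fix f :: "'a \<Rightarrow> real" assume f: "f \<in> hoelder_class \<alpha> 1 K"
    define g where "g = (P ^^ n) f"
    have g: "g \<in> hoelder_class \<alpha> 1 K"
      unfolding g_def by (rule P_hoelder_class_K[OF f])
    note int = integrable_eval_m[OF g]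
    have "e / 2 * indicator B S \<le> 1 - (g (apply_bcontfun S x) - g (apply_bcontfun S y))" for S
    proof (cases "S \<in> B")
      case True
      then have "dist T S < radius e"
        by (simp add: B_def)
      then have "merging n (e / 2) (apply_bcontfun S x) (apply_bcontfun S y)"
        using dist_fun_lt_imp_dist_val_lt by (intro merging_open[OF good e]) blast+
      then have "g (apply_bcontfun S x) - g (apply_bcontfun S y) \<le> 1 - e / 2"
        using f unfolding merging_def g_def by blast
      then show ?thesis
        using True by simp
    next
      case False
      have "g (apply_bcontfun S x) - g (apply_bcontfun S y) \<le> 1"
        using g by (auto simp: hoelder_class_def abs_le_iff)
      then show ?thesis
        using False by simp
    qed
    moreover have "integrable m (\<lambda>S. e / 2 * indicator B S)"
      by (rule m.integrable_const_bound[where B = "e / 2"]) (use e in \<open>auto simp: indicator_def\<close>)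
    ultimately have "(\<integral>S. e / 2 * indicator B S \<partial>m) \<le> (\<integral>S. 1 - (g (apply_bcontfun S x) - g (apply_bcontfun S y)) \<partial>m)"
      using int by (intro integral_mono) auto
    then have "\<delta> * (e / 2 * measure m B) \<le> \<delta> * (\<integral>S. 1 - (g (apply_bcontfun S x) - g (apply_bcontfun S y)) \<partial>m)"
      using delta by (intro mult_left_mono) auto
    then show "(P ^^ Suc n) f x - (P ^^ Suc n) f y \<le> 1 - \<delta> * (e / 2 * measure m B)"
      using P_diff_minorized[OF g, of x y] by (simp add: g_def)
  qed
  then show ?thesis
    using delta p e by (intro that[of "\<delta> * (e / 2 * measure m B)"]) auto
qed

text \<open>The outermost map is peeled off first: merging at \<open>T (U x)\<close> and
  \<open>T (U y)\<close> pulls back to \<open>U x\<close> and \<open>U y\<close>, and then through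
  \<open>U\<close> by induction. Time and gain change at each pullback, hence they are
  generalized.\<close>

lemma merging_composition:
  assumes "U \<in> finite_compositions (measure_support m)"
    and "0 < e" "merging n e (apply_bcontfun U x) (apply_bcontfun U y)"
  shows "\<exists>n'. \<exists>e'>0. merging n' e' x y"
  using assms
proof (induction arbitrary: n e)
  case (base T)
  then show ?case
    by (meson merging_support)
next
  case (step T U)
  obtain e' where "0 < e'" "merging (Suc n) e' (apply_bcontfun U x) (apply_bcontfun U y)"
    using merging_support[OF step.hyps(1) step.prems(1)] step.prems(2) unfolding apply_bcomp by blast
  then show ?case
    by (rule step.IH)
qed

text \<open>Some term of the contracting sequence brings both points near \<open>x0\<close>, and a
  finite composition of support maps approximates that term uniformly. The images under this
  composition are then close enough to merge at time \<open>0\<close>, and merging pulls back along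
  it.\<close>

lemma merging_all_pairs:
  assumes \<xi>: "\<And>n. \<xi> n \<in> closed_semigroup (measure_support m)" "contracting_sequence \<xi>"
  shows "\<exists>n. \<exists>e>0. merging n e x y"
proof -
  \<comment> \<open>A quarter, for the four legs from the image of \<open>x\<close> under
    \<open>U\<close> via \<open>\<xi> n\<close>, \<open>x0\<close> and \<open>\<xi> n\<close> again
    to the image of \<open>y\<close> under \<open>U\<close>.\<close>
  define \<eta> where "\<eta> = radius 2 / 4"
  have \<eta>: "0 < \<eta>"
    by (simp add: \<eta>_def radius_pos)
  obtain x0 where "\<And>x. (\<lambda>n. apply_bcontfun (\<xi> n) x) \<longlonglongrightarrow> x0"
    using \<xi>(2) unfolding contracting_sequence_def by blast
  then have "\<forall>\<^sub>F n in sequentially. dist (apply_bcontfun (\<xi> n) x) x0 < \<eta>"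
    "\<forall>\<^sub>F n in sequentially. dist (apply_bcontfun (\<xi> n) y) x0 < \<eta>"
    using \<eta> by (auto intro!: tendstoD)
  then have "\<forall>\<^sub>F n in sequentially. dist (apply_bcontfun (\<xi> n) x) x0 < \<eta> \<and> dist (apply_bcontfun (\<xi> n) y) x0 < \<eta>"
    by (rule eventually_conj)
  then obtain n where n: "dist (apply_bcontfun (\<xi> n) x) x0 < \<eta>" "dist (apply_bcontfun (\<xi> n) y) x0 < \<eta>"
    by (auto simp: eventually_sequentially)
  obtain U where U: "U \<in> finite_compositions (measure_support m)" "dist U (\<xi> n) < \<eta>"
    using \<xi>(1)[of n] \<eta> unfolding closed_semigroup_def closure_approachable by blast
  have "dist (apply_bcontfun U x) (apply_bcontfun (\<xi> n) x) < \<eta>"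
    "dist (apply_bcontfun U y) (apply_bcontfun (\<xi> n) y) < \<eta>"
    using U(2) dist_fun_lt_imp_dist_val_lt by blast+
  with n have "dist (apply_bcontfun U x) (apply_bcontfun U y) < 4 * \<eta>"
    using dist_triangle[of "apply_bcontfun U x" x0 "apply_bcontfun (\<xi> n) x"]
      dist_triangle[of "apply_bcontfun U y" x0 "apply_bcontfun (\<xi> n) y"]
      dist_triangle2[of "apply_bcontfun U x" "apply_bcontfun U y" x0] by linarith
  then have "merging 0 (1 / 2) (apply_bcontfun U x) (apply_bcontfun U y)"
    by (intro merging_near[where e = 2]) (auto simp: \<eta>_def)
  then show ?thesis
    using merging_composition[OF U(1), of "1/2"] by simp
qed

end

subsection \<open>The transition kernel\<close>

context hoelder_chain
begin

text \<open>The one-step law as a measure on the state space, so that the chain can be iterated with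
  the monadic \<open>bind\<close>.\<close>

definition kern :: "'a \<Rightarrow> 'a measure" where
  "kern x = distr (\<mu> x) borel (\<lambda>T. apply_bcontfun T x)"

lemma sets_kern [simp]: "sets (kern x) = sets borel"
  by (simp add: kern_def)

lemma prob_space_kern: "prob_space (kern x)"
  unfolding kern_def by (rule prob_space.prob_space_distr[OF prob_space_mu]) simp

lemma integral_kern:
  fixes f :: "'a \<Rightarrow> 'c::{banach, second_countable_topology}"
  assumes "f \<in> borel_measurable borel"
  shows "(\<integral>y. f y \<partial>kern x) = (\<integral>T. f (apply_bcontfun T x) \<partial>\<mu> x)"
  unfolding kern_def using assms by (intro integral_distr) auto

lemma P_eq_integral_kern:
  "f \<in> hoelder_class \<alpha> a b \<Longrightarrow> P f x = (\<integral>y. f y \<partial>kern x)"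
  unfolding P_def by (rule integral_kern[symmetric, OF hoelder_class_measurable[OF alpha(1)]])

lemma P_measurable:
  assumes "f \<in> hoelder_class \<alpha> a b"
  shows "P f \<in> borel_measurable borel"
proof -
  have "f \<in> hoelder_class \<alpha> a (max 0 b)"
    using assms by (rule hoelder_class_mono) auto
  then show ?thesis
    using hoelder_class_measurable[OF alpha(1) P_hoelder_class] by (meson max.cobounded1)
qed

text \<open>For closed \<open>A\<close> the map \<open>x \<mapsto> kern x A\<close> is a pointwise
  limit of functions \<open>P (f k)\<close>, each continuous by the Lasota--Yorke inequality; closed
  sets generate.\<close>

lemma kern_measurable: "kern \<in> borel \<rightarrow>\<^sub>M prob_algebra borel"
proof (rule measurable_prob_algebra_generated[where G = "Collect closed" and \<Omega> = UNIV])
  show "sets (borel :: 'a measure) = sigma_sets UNIV (Collect closed)"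
    by (simp add: borel_eq_closed)
  show "Int_stable (Collect closed :: 'a set set)"
    by (auto simp: Int_stable_def)
  fix A :: "'a set" assume "A \<in> Collect closed"
  then have A: "closed A"
    by simp
  show "(\<lambda>x. emeasure (kern x) A) \<in> borel_measurable borel"
  proof (rule closed_indicator_limit_hoelder[OF A alpha])
    fix f :: "nat \<Rightarrow> 'a \<Rightarrow> real" and b
    assume f: "\<And>k. f k \<in> hoelder_class \<alpha> 1 (b k)" "\<And>k x. 0 \<le> f k x" "\<And>k x. f k x \<le> 1"
      "\<And>x. (\<lambda>k. f k x) \<longlonglongrightarrow> indicator A x"
    have meas: "f k \<in> borel_measurable (kern x)" for k x
      using hoelder_class_measurable[OF alpha(1) f(1)[of k]] measurable_cong_sets[OF sets_kern refl] by blast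
    have "(\<lambda>k. P (f k) x) \<longlonglongrightarrow> measure (kern x) A" for x
      unfolding P_eq_integral_kern[OF f(1)]
      using A f by (intro integral_limit_indicator prob_space_kern meas) auto
    then have "(\<lambda>x. measure (kern x) A) \<in> borel_measurable borel"
      by (rule borel_measurable_LIMSEQ_real[OF _ P_measurable[OF f(1)]])
    then show ?thesis
      by (simp add: finite_measure.emeasure_eq_measure[OF prob_space.finite_measure[OF prob_space_kern]])
  qed
qed (auto intro: prob_space_kern)

lemma kern_measurable_subprob [measurable]: "kern \<in> borel \<rightarrow>\<^sub>M subprob_algebra borel"
  by (rule measurable_prob_algebraD[OF kern_measurable])

lemma bind_kern:
  assumes "\<nu> \<in> space (prob_algebra borel)"
  shows "\<nu> \<bind> kern \<in> space (prob_algebra borel)"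
  using prob_space_bind'[OF assms kern_measurable] sets_bind'[OF assms kern_measurable]
  by (simp add: space_prob_algebra)

lemma integral_bind_kern:
  fixes f :: "'a \<Rightarrow> real"
  assumes \<nu>: "\<nu> \<in> space (prob_algebra borel)"
    and f: "f \<in> borel_measurable borel" "\<And>x. \<bar>f x\<bar> \<le> B"
  shows "(\<integral>x. f x \<partial>(\<nu> \<bind> kern)) = (\<integral>x. (\<integral>y. f y \<partial>kern x) \<partial>\<nu>)"
proof (rule integral_bind[where K = borel and B' = 1 and B = B])
  have "sets \<nu> = sets borel" and p: "prob_space \<nu>"
    using \<nu> by (auto simp: space_prob_algebra)
  then show "kern \<in> \<nu> \<rightarrow>\<^sub>M subprob_algebra borel"
    using kern_measurable_subprob measurable_cong_sets by blast
  show "finite_measure \<nu>"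
    using p by (rule prob_space.finite_measure)
  show "AE x in \<nu>. emeasure (kern x) (space (kern x)) \<le> ennreal 1"
    by (simp add: prob_space.emeasure_space_1[OF prob_space_kern])
qed (use f in auto)

lemma integral_bind_kern_P:
  assumes \<nu>: "\<nu> \<in> space (prob_algebra borel)" and f: "f \<in> hoelder_class \<alpha> a b"
  shows "(\<integral>x. f x \<partial>(\<nu> \<bind> kern)) = (\<integral>x. P f x \<partial>\<nu>)"
proof -
  obtain c where c: "\<And>x. c \<le> f x" "\<And>x. f x \<le> c + a"
    using hoelder_class_range[OF f] by blast
  have "\<bar>f z\<bar> \<le> \<bar>c\<bar> + \<bar>a\<bar>" for z
    using c[of z] by linarith
  then show ?thesis
    unfolding P_eq_integral_kern[OF f]
    by (rule integral_bind_kern[OF \<nu> hoelder_class_measurable[OF alpha(1) f]])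
qed

lemma transition_op_Complex:
  assumes f: "f \<in> hoelder_class \<alpha> a b" and g: "g \<in> hoelder_class \<alpha> a' b'"
  shows "transition_op \<mu> (\<lambda>y. Complex (f y) (g y)) = (\<lambda>x. Complex (P f x) (P g x))"
proof
  fix x
  have "transition_op \<mu> (\<lambda>y. Complex (f y) (g y)) x
      = (\<integral>T. complex_of_real (f (apply_bcontfun T x)) + \<i> * complex_of_real (g (apply_bcontfun T x)) \<partial>\<mu> x)"
    by (simp add: transition_op_def Complex_eq)
  also have "\<dots> = complex_of_real (P f x) + \<i> * complex_of_real (P g x)"
    using integrable_eval[OF f] integrable_eval[OF g] unfolding P_def
    by (subst Bochner_Integration.integral_add) auto
  finally show "transition_op \<mu> (\<lambda>y. Complex (f y) (g y)) x = Complex (P f x) (P g x)"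
    by (simp add: Complex_eq)
qed

lemma transition_op_pow_Complex:
  assumes f: "f \<in> hoelder_class \<alpha> a b" and g: "g \<in> hoelder_class \<alpha> a b" and b: "0 \<le> b"
  shows "(transition_op \<mu> ^^ n) (\<lambda>y. Complex (f y) (g y)) = (\<lambda>x. Complex ((P ^^ n) f x) ((P ^^ n) g x))"
proof (induction n)
  case (Suc n)
  then show ?case
    using transition_op_Complex[OF P_pow_hoelder_class[OF f b] P_pow_hoelder_class[OF g b]] by simp
qed simp

lemma invariant_P:
  assumes \<nu>: "invariant_prob \<mu> \<nu>" and f: "f \<in> hoelder_class \<alpha> a b"
  shows "(\<integral>x. P f x \<partial>\<nu>) = (\<integral>x. f x \<partial>\<nu>)"
proof -
  obtain c where c: "\<And>x. c \<le> f x" "\<And>x. f x \<le> c + a"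
    using hoelder_class_range[OF f] by blast
  have "\<bar>f z\<bar> \<le> \<bar>c\<bar> + \<bar>a\<bar>" for z
    using c[of z] by linarith
  then have bdd: "bounded (range (\<lambda>x. complex_of_real (f x)))"
    by (auto simp: bounded_iff)
  have [measurable]: "f \<in> borel_measurable borel"
    by (rule hoelder_class_measurable[OF alpha(1) f])
  have "(\<lambda>x. complex_of_real (f x)) \<in> borel_measurable borel"
    by measurable
  moreover have "\<forall>\<phi> \<in> borel_measurable borel. bounded (range \<phi>) \<longrightarrow>
      (\<integral>x. transition_op \<mu> \<phi> x \<partial>\<nu>) = (\<integral>x. \<phi> x \<partial>\<nu>)"
    using \<nu> unfolding invariant_prob_def by (elim conjE)
  ultimately have "(\<integral>x. transition_op \<mu> (\<lambda>y. complex_of_real (f y)) x \<partial>\<nu>) = (\<integral>x. complex_of_real (f x) \<partial>\<nu>)"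
    using bdd by blast
  moreover have "transition_op \<mu> (\<lambda>y. complex_of_real (f y)) x = complex_of_real (P f x)" for x
    by (simp add: transition_op_def P_def)
  ultimately show ?thesis
    by simp
qed

lemma invariant_P_pow:
  assumes \<nu>: "invariant_prob \<mu> \<nu>" and f: "f \<in> hoelder_class \<alpha> a b" and b: "0 \<le> b"
  shows "(\<integral>x. (P ^^ n) f x \<partial>\<nu>) = (\<integral>x. f x \<partial>\<nu>)"
proof (induction n)
  case (Suc n)
  then show ?case
    using invariant_P[OF \<nu> P_pow_hoelder_class[OF f b]] by simp
qed simp

text \<open>The fixed-point equation for \<open>bind\<close> gives invariance against bounded real
  Borel functions; complex ones follow through real and imaginary parts.\<close>

lemma invariant_probI:
  assumes \<nu>: "\<nu> \<in> space (prob_algebra borel)" and bind: "\<nu> \<bind> kern = \<nu>"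
  shows "invariant_prob \<mu> \<nu>"
  unfolding invariant_prob_def
proof (intro conjI ballI impI)
  show p: "prob_space \<nu>" and s: "sets \<nu> = sets borel"
    using \<nu> by (auto simp: space_prob_algebra)
  interpret prob_space \<nu> by fact
  fix \<phi> :: "'a \<Rightarrow> complex" assume [measurable]: "\<phi> \<in> borel_measurable borel" and "bounded (range \<phi>)"
  then obtain B where B: "\<And>x. norm (\<phi> x) \<le> B"
    unfolding bounded_iff by auto
  note [measurable_cong] = s
  have ReB: "\<bar>Re (\<phi> x)\<bar> \<le> B" and ImB: "\<bar>Im (\<phi> x)\<bar> \<le> B" for x
    using B[of x] abs_Re_le_cmod[of "\<phi> x"] abs_Im_le_cmod[of "\<phi> x"] by linarith+
  have int: "integrable M \<phi>" if "prob_space M" "sets M = sets borel" for M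
    using B that(2) measurable_cong_sets[OF that(2) refl]
    by (intro finite_measure.integrable_const_bound[OF prob_space.finite_measure[OF that(1)], where B = B]) auto
  have op: "transition_op \<mu> \<phi> x = Complex (\<integral>y. Re (\<phi> y) \<partial>kern x) (\<integral>y. Im (\<phi> y) \<partial>kern x)" for x
  proof -
    have "transition_op \<mu> \<phi> x = (\<integral>y. \<phi> y \<partial>kern x)"
      unfolding transition_op_def by (rule integral_kern[symmetric]) simp
    then show ?thesis
      using int[OF prob_space_kern sets_kern] by (simp add: complex_eq_iff)
  qed
  have [measurable]: "(\<lambda>x. \<integral>y. h y \<partial>kern x) \<in> borel_measurable borel"
    if [measurable]: "h \<in> borel_measurable borel" for h :: "'a \<Rightarrow> real"
    by (rule measurable_compose[OF kern_measurable_subprob integral_measurable_subprob_algebra]) simp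
  have le: "\<bar>\<integral>y. h y \<partial>kern x\<bar> \<le> B"
    if h: "h \<in> borel_measurable borel" and hB: "\<And>y. \<bar>h y\<bar> \<le> B" for h :: "'a \<Rightarrow> real" and x
  proof -
    interpret k: prob_space "kern x" by (rule prob_space_kern)
    have "h \<in> borel_measurable (kern x)"
      using h by (subst measurable_cong_sets[OF sets_kern refl])
    then have "integrable (kern x) h"
      by (intro k.integrable_const_bound[where B = B]) (use hB in auto)
    then have "(\<integral>y. h y \<partial>kern x) \<le> B" "- B \<le> (\<integral>y. h y \<partial>kern x)"
      using hB by (auto intro!: k.integral_le_const k.integral_ge_const simp: abs_le_iff minus_le_iff)
    then show ?thesis
      by linarith
  qed
  have intR: "integrable \<nu> (\<lambda>x. \<integral>y. Re (\<phi> y) \<partial>kern x)" and intI: "integrable \<nu> (\<lambda>x. \<integral>y. Im (\<phi> y) \<partial>kern x)"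
    by (rule integrable_const_bound[where B = B]; use le ReB ImB in simp)+
  have "(\<integral>x. transition_op \<mu> \<phi> x \<partial>\<nu>)
      = (\<integral>x. complex_of_real (\<integral>y. Re (\<phi> y) \<partial>kern x) + \<i> * complex_of_real (\<integral>y. Im (\<phi> y) \<partial>kern x) \<partial>\<nu>)"
    by (simp add: op Complex_eq)
  also have "\<dots> = complex_of_real (\<integral>x. (\<integral>y. Re (\<phi> y) \<partial>kern x) \<partial>\<nu>)
      + \<i> * complex_of_real (\<integral>x. (\<integral>y. Im (\<phi> y) \<partial>kern x) \<partial>\<nu>)"
    using intR intI by (subst Bochner_Integration.integral_add) auto
  also have "\<dots> = complex_of_real (\<integral>x. Re (\<phi> x) \<partial>\<nu>) + \<i> * complex_of_real (\<integral>x. Im (\<phi> x) \<partial>\<nu>)"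
    using integral_bind_kern[OF \<nu> _ ReB] integral_bind_kern[OF \<nu> _ ImB] bind by simp
  also have "\<dots> = (\<integral>x. \<phi> x \<partial>\<nu>)"
    using int[OF p s] by (simp add: complex_eq_iff)
  finally show "(\<integral>x. transition_op \<mu> \<phi> x \<partial>\<nu>) = (\<integral>x. \<phi> x \<partial>\<nu>)" .
qed

end

subsection \<open>Geometric ergodicity\<close>

context minorized_hoelder_chain
begin

text \<open>Each pair merges together with a whole neighbourhood. Finitely many neighbourhoods cover
  the compact square, and the largest time with the smallest gain serves all pairs.\<close>

lemma uniform_merging:
  assumes cpt: "compact (UNIV :: 'a set)" and all: "\<And>x y. \<exists>n. \<exists>e>0. merging n e x y"
  obtains e n where "0 < e" "\<And>x y. merging n e x y"
proof -
  have "\<forall>p. \<exists>n e. 0 < e \<and> merging n e (fst p) (snd p)"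
    using all by blast
  then obtain e n where ne: "\<And>p. 0 < e p" "\<And>p. merging (n p) (e p) (fst p) (snd p)"
    by metis
  define V where "V p = ball (fst p) (radius (e p)) \<times> ball (snd p) (radius (e p))" for p
  have "compact (UNIV :: ('a \<times> 'a) set)"
    using compact_Times[OF cpt cpt] by simp
  moreover have "open (V p)" for p
    by (simp add: V_def open_Times)
  moreover have "UNIV \<subseteq> (\<Union>p\<in>UNIV. V p)"
  proof
    fix p
    have "p \<in> V p"
      using radius_pos[OF ne(1)[of p]] by (cases p) (simp add: V_def)
    then show "p \<in> (\<Union>p\<in>UNIV. V p)"
      by blast
  qed
  ultimately obtain F where F: "finite F" "UNIV \<subseteq> (\<Union>p\<in>F. V p)"
    by (rule compactE_image[of UNIV UNIV V]) blast+
  \<comment> \<open>The inserted \<open>0\<close> and \<open>1\<close> avoid \<open>Max\<close> and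
    \<open>Min\<close> of an empty set; gains are halved by the passage to neighbourhoods.\<close>
  define N where "N = Max (insert 0 (n ` F))"
  define \<epsilon> where "\<epsilon> = Min (insert 1 ((\<lambda>p. e p / 2) ` F))"
  show ?thesis
  proof
    show "0 < \<epsilon>"
      using F(1) ne(1) by (simp add: \<epsilon>_def)
    fix x y
    obtain p where p: "p \<in> F" "(x, y) \<in> V p"
      using F(2) by blast
    then have "merging (n p) (e p / 2) x y"
      by (intro merging_open[OF ne(2) ne(1)]) (auto simp: V_def)
    moreover have "n p \<le> N"
      unfolding N_def by (rule Max_ge) (use F(1) p(1) in auto)
    moreover have "\<epsilon> \<le> e p / 2"
      unfolding \<epsilon>_def by (rule Min_le) (use F(1) p(1) in auto)
    ultimately show "merging N \<epsilon> x y"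
      by (rule merging_mono)
  qed
qed

text \<open>The first \<open>n\<close> steps lower the oscillation from \<open>1\<close> to
  \<open>\<rho>\<close> while keeping the Hoelder constant \<open>K\<close>. Then \<open>j\<close>
  further steps lower the Hoelder constant to \<open>\<rho> * K\<close> without raising the
  oscillation, so both shrink by the same factor and the argument can be iterated.\<close>

lemma eventual_contraction:
  assumes e: "0 < e" and merge: "\<And>x y. merging n e x y"
  obtains M \<rho> where "0 < M" "0 < \<rho>" "\<rho> < 1"
    "\<And>f t. f \<in> hoelder_class \<alpha> t (t * K) \<Longrightarrow> (P ^^ M) f \<in> hoelder_class \<alpha> (\<rho> * t) (\<rho> * t * K)"
proof -
  obtain j where j: "r ^ j < 1 / 4"
    using real_arch_pow_inv[of "1/4" r] r by auto
  \<comment> \<open>Secures a positive block length \<open>j + n\<close> even if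
    \<open>n = 0\<close>.\<close>
  then have "0 < j"
    by (cases j) auto
  \<comment> \<open>The floor \<open>3 / 4\<close> absorbs the remainder: \<open>r ^ j * K\<close>
    is at most \<open>K / 4\<close>, hence below \<open>\<rho> * K / 2\<close>. It also keeps
    \<open>\<rho>\<close> positive if \<open>e\<close> is at least \<open>1\<close>.\<close>
  define \<rho> where "\<rho> = max (1 - e) (3 / 4)"
  have \<rho>: "3 / 4 \<le> \<rho>" "\<rho> < 1" "1 - e \<le> \<rho>"
    using e by (auto simp: \<rho>_def)
  have unit: "(P ^^ (j + n)) f \<in> hoelder_class \<alpha> \<rho> (\<rho> * K)" if f: "f \<in> hoelder_class \<alpha> 1 K" for f
  proof -
    have "\<bar>(P ^^ n) f x - (P ^^ n) f y\<bar> \<le> \<rho>" for x y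
      using merge[of x y] merge[of y x] f \<rho>(3) unfolding merging_def by fastforce
    then have "(P ^^ n) f \<in> hoelder_class \<alpha> \<rho> K"
      using P_hoelder_class_K[OF f, of n] by (auto simp: hoelder_class_def)
    then have "(P ^^ j) ((P ^^ n) f) \<in> hoelder_class \<alpha> \<rho> (r ^ j * K + R / (1 - r) * \<rho>)"
      using K by (intro P_pow_hoelder_class) auto
    moreover have "r ^ j * K + R / (1 - r) * \<rho> \<le> \<rho> * K"
    proof -
      have "r ^ j * K \<le> 1 / 4 * K"
        using j K by (intro mult_right_mono) auto
      moreover have "R / (1 - r) \<le> K / 2"
        using K by linarith
      then have "R / (1 - r) * \<rho> \<le> K / 2 * \<rho>"
        using \<rho> by (intro mult_right_mono) auto
      moreover have "3 / 4 * K \<le> \<rho> * K"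
        using K \<rho> by (intro mult_right_mono) auto
      moreover have "K / 2 * \<rho> = \<rho> * K / 2"
        by simp
      ultimately show ?thesis
        using K by linarith
    qed
    ultimately show ?thesis
      using hoelder_class_mono by (fastforce simp: funpow_add)
  qed
  have "(P ^^ (j + n)) f \<in> hoelder_class \<alpha> (\<rho> * t) (\<rho> * t * K)" if f: "f \<in> hoelder_class \<alpha> t (t * K)" for f t
  proof (cases "t = 0")
    \<comment> \<open>Here \<open>f\<close> is constant and cannot be normalized by
      \<open>t\<close>.\<close>
    case True
    then show ?thesis
      using P_pow_hoelder_class[of f 0 0 "j + n"] f by simp
  next
    case False
    then have t: "0 < t"
      using hoelder_class_nonneg[OF f] by simp
    have "(\<lambda>x. inverse t * f x) \<in> hoelder_class \<alpha> 1 K"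
      using hoelder_class_scale[OF f, of "inverse t"] t by (simp flip: mult.assoc)
    then have "(\<lambda>x. t * (P ^^ (j + n)) (\<lambda>x. inverse t * f x) x) \<in> hoelder_class \<alpha> (t * \<rho>) (t * (\<rho> * K))"
      using t by (intro hoelder_class_scale unit) auto
    then show ?thesis
      using t unfolding P_pow_scale by (simp add: mult.commute[of t \<rho>] flip: mult.assoc)
  qed
  then show ?thesis
    using that[of "j + n" \<rho>] \<open>0 < j\<close> \<rho> by auto
qed

text \<open>Split \<open>k\<close> into \<open>q\<close> full blocks of length \<open>M\<close> and
  a rest \<open>s < M\<close>. Each block contracts by \<open>\<rho>\<close>, and the rest does not
  increase the oscillation. With \<open>\<theta>\<close> the \<open>M\<close>-th root of
  \<open>\<rho>\<close>, the incomplete block costs at most the factor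
  \<open>1 / \<rho>\<close>.\<close>

lemma geometric_decay:
  assumes e: "0 < e" and merge: "\<And>x y. merging n e x y"
  obtains C \<theta> where "0 < C" "0 < \<theta>" "\<theta> < 1"
    "\<And>f t k x y. f \<in> hoelder_class \<alpha> t (t * K) \<Longrightarrow> \<bar>(P ^^ k) f x - (P ^^ k) f y\<bar> \<le> C * \<theta> ^ k * t"
proof -
  obtain M \<rho> where M: "0 < M" and \<rho>: "0 < \<rho>" "\<rho> < 1" and contr:
    "\<And>f t. f \<in> hoelder_class \<alpha> t (t * K) \<Longrightarrow> (P ^^ M) f \<in> hoelder_class \<alpha> (\<rho> * t) (\<rho> * t * K)"
    using eventual_contraction[OF e merge] by metis
  define \<theta> where "\<theta> = root M \<rho>"
  have \<theta>: "0 < \<theta>" "\<theta> < 1" "\<theta> ^ M = \<rho>"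
    using M \<rho> by (auto simp: \<theta>_def)
  have iter: "(P ^^ (M * q)) f \<in> hoelder_class \<alpha> (\<rho> ^ q * t) (\<rho> ^ q * t * K)"
    if f: "f \<in> hoelder_class \<alpha> t (t * K)" for f t q
  proof (induction q)
    case (Suc q)
    have "(P ^^ (M * Suc q)) f = (P ^^ M) ((P ^^ (M * q)) f)"
      by (simp add: funpow_add)
    then show ?case
      using contr[OF Suc] by (simp add: mult_ac)
  qed (use f in simp)
  have "\<bar>(P ^^ k) f x - (P ^^ k) f y\<bar> \<le> 1 / \<rho> * \<theta> ^ k * t"
    if f: "f \<in> hoelder_class \<alpha> t (t * K)" for f t k x y
  proof -
    have t: "0 \<le> t"
      by (rule hoelder_class_nonneg[OF f])
    define q s where "q = k div M" and "s = k mod M"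
    have k: "k = s + M * q" and s: "s < M"
      using M by (auto simp: q_def s_def)
    have "(P ^^ s) ((P ^^ (M * q)) f) \<in> hoelder_class \<alpha> (\<rho> ^ q * t)
        (r ^ s * (\<rho> ^ q * t * K) + R / (1 - r) * (\<rho> ^ q * t))"
      using t K \<rho> by (intro P_pow_hoelder_class iter f) auto
    then have "\<bar>(P ^^ k) f x - (P ^^ k) f y\<bar> \<le> \<rho> ^ q * t"
      unfolding k funpow_add by (auto simp: hoelder_class_def)
    also have "\<rho> ^ q \<le> 1 / \<rho> * \<theta> ^ k"
    proof -
      have "\<rho> ^ q * \<theta> ^ M \<le> \<rho> ^ q * \<theta> ^ s"
        using \<theta> \<rho> s by (intro mult_left_mono power_decreasing) auto
      moreover have "\<theta> ^ k = \<rho> ^ q * \<theta> ^ s"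
        unfolding k power_add power_mult \<theta>(3) by simp
      ultimately show ?thesis
        using \<rho> \<theta>(3) by (simp add: field_simps)
    qed
    then have "\<rho> ^ q * t \<le> 1 / \<rho> * \<theta> ^ k * t"
      using t by (rule mult_right_mono)
    finally show ?thesis .
  qed
  then show ?thesis
    using \<rho> \<theta> by (intro that[of "1 / \<rho>" \<theta>]) auto
qed

end

section \<open>Existence, uniqueness and rate from decay of oscillation\<close>

text \<open>Only the decay of oscillations is retained from the merging argument. \<open>K\<close>
  is a parameter here, instantiated in the end with the constant of the same name.\<close>

locale ergodic_hoelder_chain = hoelder_chain +
  fixes K C \<theta> :: real
  assumes K: "0 < K" and C: "0 < C" and \<theta>: "0 < \<theta>" "\<theta> < 1"
    and decay: "\<And>f t n x y. f \<in> hoelder_class \<alpha> t (t * K) \<Longrightarrow> \<bar>(P ^^ n) f x - (P ^^ n) f y\<bar> \<le> C * \<theta> ^ n * t"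
begin

text \<open>Brings an arbitrary Hoelder function into the form with ratio \<open>K\<close> that
  \<open>decay\<close> expects; \<open>a + b / K\<close> dominates both requirements.\<close>

lemma hoelder_class_balanced:
  assumes "f \<in> hoelder_class \<alpha> a b" "0 \<le> a" "0 \<le> b"
  shows "f \<in> hoelder_class \<alpha> (a + b / K) ((a + b / K) * K)"
  using assms(1) by (rule hoelder_class_mono) (use assms K in \<open>auto simp: field_simps\<close>)

text \<open>By invariance the integral of \<open>f\<close> is that of \<open>(P ^^ n) f\<close>, an
  average of values that all lie within the decay bound of the value at \<open>x\<close>.\<close>

lemma invariant_rate:
  assumes \<nu>: "invariant_prob \<mu> \<nu>" and f: "f \<in> hoelder_class \<alpha> t (t * K)"
  shows "\<bar>(P ^^ n) f x - (\<integral>y. f y \<partial>\<nu>)\<bar> \<le> C * \<theta> ^ n * t"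
proof -
  interpret prob_space \<nu>
    using \<nu> by (simp add: invariant_prob_def)
  have sets: "sets \<nu> = sets borel"
    using \<nu> by (simp add: invariant_prob_def)
  have tK: "0 \<le> t * K"
    using hoelder_class_nonneg[OF f] K by simp
  note g = P_pow_hoelder_class[OF f tK, of n]
  have b: "(P ^^ n) f y \<le> (P ^^ n) f x + C * \<theta> ^ n * t" "(P ^^ n) f x - C * \<theta> ^ n * t \<le> (P ^^ n) f y" for y
    using decay[OF f, of n x y] by linarith+
  have "\<bar>(P ^^ n) f y\<bar> \<le> \<bar>(P ^^ n) f x\<bar> + C * \<theta> ^ n * t" for y
    using decay[OF f, of n y x] by linarith
  then have "integrable \<nu> ((P ^^ n) f)"
    using hoelder_class_measurable[OF alpha(1) g] measurable_cong_sets[OF sets refl]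
    by (intro integrable_const_bound[where B = "\<bar>(P ^^ n) f x\<bar> + C * \<theta> ^ n * t"]) auto
  then have "(\<integral>y. (P ^^ n) f y \<partial>\<nu>) \<le> (P ^^ n) f x + C * \<theta> ^ n * t"
    "(P ^^ n) f x - C * \<theta> ^ n * t \<le> (\<integral>y. (P ^^ n) f y \<partial>\<nu>)"
    using b by (auto intro!: integral_le_const integral_ge_const)
  then show ?thesis
    unfolding invariant_P_pow[OF \<nu> f tK] by linarith
qed

lemma decay_limit: "(\<lambda>n. C * \<theta> ^ n * t) \<longlonglongrightarrow> 0"
  using tendsto_mult_left_zero[OF tendsto_mult_right_zero[OF LIMSEQ_realpow_zero]] \<theta> by simp

text \<open>Both integrals of a Hoelder function are the limit of \<open>(P ^^ n) f\<close> at one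
  and the same point, for which \<open>undefined\<close> serves as an arbitrary choice.\<close>

lemma invariant_unique:
  assumes \<nu>: "invariant_prob \<mu> \<nu>" and \<nu>': "invariant_prob \<mu> \<nu>'"
  shows "\<nu> = \<nu>'"
proof (rule prob_measure_eqI_hoelder[OF _ _ _ _ alpha])
  fix f :: "'a \<Rightarrow> real" and b assume "f \<in> hoelder_class \<alpha> 1 b"
  then have "f \<in> hoelder_class \<alpha> 1 (max 0 b)"
    by (rule hoelder_class_mono) auto
  from hoelder_class_balanced[OF this]
  obtain t where t: "f \<in> hoelder_class \<alpha> t (t * K)"
    by auto
  have "(\<lambda>n. (P ^^ n) f undefined - (\<integral>y. f y \<partial>\<kappa>)) \<longlonglongrightarrow> 0" if "invariant_prob \<mu> \<kappa>" for \<kappa>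
    by (rule Lim_null_comparison[OF always_eventually decay_limit])
      (use invariant_rate[OF that t] in auto)
  then have "(\<lambda>n. (P ^^ n) f undefined) \<longlonglongrightarrow> (\<integral>y. f y \<partial>\<kappa>)" if "invariant_prob \<mu> \<kappa>" for \<kappa>
    using that by (simp add: LIM_zero_cancel)
  then show "(\<integral>x. f x \<partial>\<nu>) = (\<integral>x. f x \<partial>\<nu>')"
    using LIMSEQ_unique \<nu> \<nu>' by blast
qed (use \<nu> \<nu>' in \<open>auto simp: invariant_prob_def\<close>)

text \<open>Distribution at time \<open>n\<close> of the chain started at the arbitrary point
  \<open>undefined\<close>.\<close>

primrec law :: "nat \<Rightarrow> 'a measure" where
  "law 0 = return borel undefined"
| "law (Suc n) = law n \<bind> kern"

lemma law_prob: "law n \<in> space (prob_algebra borel)"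
proof (induction n)
  case 0
  then show ?case
    by (simp add: space_prob_algebra prob_space_return)
qed (simp add: bind_kern)

text \<open>The last kernel of \<open>law\<close> acts on the test function first, turning
  \<open>f\<close> into \<open>P f\<close>; the induction therefore generalizes over
  \<open>f\<close> and its Hoelder constant.\<close>

lemma integral_law:
  assumes "f \<in> hoelder_class \<alpha> a b" "0 \<le> a" "0 \<le> b"
  shows "(\<integral>x. f x \<partial>law n) = (P ^^ n) f undefined"
  using assms
proof (induction n arbitrary: f b)
  case 0
  then show ?case
    using hoelder_class_measurable[OF alpha(1) 0(1)] by (simp add: integral_return)
next
  case (Suc n)
  have "(\<integral>x. f x \<partial>law (Suc n)) = (\<integral>x. P f x \<partial>law n)"
    using integral_bind_kern_P[OF law_prob Suc.prems(1)] by simp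
  also have "\<dots> = (P ^^ n) (P f) undefined"
    using Suc.prems r R by (intro Suc.IH[OF P_hoelder_class[OF Suc.prems(1,3)]]) auto
  finally show ?case
    by (simp add: funpow_swap1)
qed

text \<open>A weak limit of the laws themselves, without averaging over time, is invariant:
  consecutive iterates at the starting point differ by a quantity tending to \<open>0\<close>, and
  \<open>P f\<close> is again continuous, so both integrals pass to the limit.\<close>

lemma invariant_exists:
  assumes cpt: "compact (UNIV :: 'a set)"
  shows "\<exists>\<nu>. invariant_prob \<mu> \<nu>"
proof -
  have law: "prob_space (law n)" "sets (law n) = sets borel" for n
    using law_prob[of n] by (auto simp: space_prob_algebra)
  obtain s \<nu> where s: "strict_mono (s :: nat \<Rightarrow> nat)" and \<nu>: "prob_space \<nu>" "sets \<nu> = sets borel"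
    and lim: "\<And>f :: 'a \<Rightarrow> real. continuous_on UNIV f \<Longrightarrow> (\<lambda>k. \<integral>x. f x \<partial>law (s k)) \<longlonglongrightarrow> (\<integral>x. f x \<partial>\<nu>)"
    using compact_weak_convergent_subsequence[of law, OF cpt law] by blast
  have \<nu>': "\<nu> \<in> space (prob_algebra borel)"
    using \<nu> by (simp add: space_prob_algebra)
  have "\<nu> \<bind> kern = \<nu>"
  proof (rule prob_measure_eqI_hoelder[OF _ _ \<nu> alpha])
    show "prob_space (\<nu> \<bind> kern)" "sets (\<nu> \<bind> kern) = sets borel"
      using bind_kern[OF \<nu>'] by (auto simp: space_prob_algebra)
    fix f :: "'a \<Rightarrow> real" and b assume "f \<in> hoelder_class \<alpha> 1 b"
    then have "f \<in> hoelder_class \<alpha> 1 (max 0 b)"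
      by (rule hoelder_class_mono) auto
    from hoelder_class_balanced[OF this]
    obtain t where f: "f \<in> hoelder_class \<alpha> t (t * K)"
      by auto
    have t: "0 \<le> t" "0 \<le> t * K"
      using hoelder_class_nonneg[OF f] K by auto
    note Pf = P_hoelder_class[OF f t(2)]
    have diff: "(\<lambda>k. (P ^^ s k) (P f) undefined - (P ^^ s k) f undefined) \<longlonglongrightarrow> 0"
    proof (rule Lim_null_comparison[OF always_eventually])
      \<comment> \<open>One more application of \<open>P\<close> averages values of
        \<open>(P ^^ n) f\<close>, all of them within the decay bound of the value at
        \<open>undefined\<close>.\<close>
      have "\<bar>P ((P ^^ n) f) undefined - (P ^^ n) f undefined\<bar> \<le> C * \<theta> ^ n * t" for n
      proof -
        have "(P ^^ n) f undefined - C * \<theta> ^ n * t \<le> (P ^^ n) f y"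
          "(P ^^ n) f y \<le> (P ^^ n) f undefined + C * \<theta> ^ n * t" for y
          using decay[OF f, of n undefined y] by linarith+
        from P_range[OF P_pow_hoelder_class[OF f t(2)] this, of undefined]
        show ?thesis
          by linarith
      qed
      then show "\<forall>k. norm ((P ^^ s k) (P f) undefined - (P ^^ s k) f undefined) \<le> C * \<theta> ^ s k * t"
        by (simp add: funpow_swap1)
      show "(\<lambda>k. C * \<theta> ^ s k * t) \<longlonglongrightarrow> 0"
        using LIMSEQ_subseq_LIMSEQ[OF decay_limit s] by (simp add: o_def)
    qed
    have Plim: "(\<lambda>k. (P ^^ s k) (P f) undefined) \<longlonglongrightarrow> (\<integral>x. P f x \<partial>\<nu>)"
      using lim[OF hoelder_class_continuous[OF alpha(1) Pf]] integral_law[OF Pf] t r R by simp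
    have flim: "(\<lambda>k. (P ^^ s k) f undefined) \<longlonglongrightarrow> (\<integral>x. f x \<partial>\<nu>)"
      using lim[OF hoelder_class_continuous[OF alpha(1) f]] integral_law[OF f] t by simp
    have "(\<integral>x. P f x \<partial>\<nu>) - (\<integral>x. f x \<partial>\<nu>) = 0"
      by (rule LIMSEQ_unique[OF tendsto_diff[OF Plim flim] diff])
    then show "(\<integral>x. f x \<partial>(\<nu> \<bind> kern)) = (\<integral>x. f x \<partial>\<nu>)"
      using integral_bind_kern_P[OF \<nu>' f] by simp
  qed
  then show ?thesis
    using invariant_probI[OF \<nu>'] by blast
qed

text \<open>Real and imaginary parts have oscillation at most \<open>2 * B\<close> and Hoelder
  constant at most \<open>B\<close>, which balances to \<open>t = (2 + 1 / K) * B\<close>. Adding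
  the bounds for the two parts gives the leading factor 2.\<close>

lemma complex_rate:
  assumes \<nu>: "invariant_prob \<mu> \<nu>" and B: "0 \<le> B" "\<And>x. cmod (\<phi> x) \<le> B"
    "\<And>x y. cmod (\<phi> x - \<phi> y) \<le> B * dist x y powr \<alpha>"
  shows "cmod ((transition_op \<mu> ^^ n) \<phi> x - (\<integral>y. \<phi> y \<partial>\<nu>)) \<le> 2 * C * (2 + 1 / K) * \<theta> ^ n * B"
proof -
  interpret \<nu>: prob_space \<nu>
    using \<nu> by (simp add: invariant_prob_def)
  have sets: "sets \<nu> = sets borel"
    using \<nu> by (simp add: invariant_prob_def)
  define f g where "f x = Re (\<phi> x)" and "g x = Im (\<phi> x)" for x
  have \<phi>: "\<phi> = (\<lambda>x. Complex (f x) (g x))"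
    by (simp add: f_def g_def)
  have osc: "cmod (\<phi> x - \<phi> y) \<le> 2 * B" for x y
    using norm_triangle_ineq4[of "\<phi> x" "\<phi> y"] B(2)[of x] B(2)[of y] by linarith
  have "\<bar>f x - f y\<bar> \<le> cmod (\<phi> x - \<phi> y)" "\<bar>g x - g y\<bar> \<le> cmod (\<phi> x - \<phi> y)" for x y
    using abs_Re_le_cmod[of "\<phi> x - \<phi> y"] abs_Im_le_cmod[of "\<phi> x - \<phi> y"] by (simp_all add: f_def g_def)
  then have fg: "f \<in> hoelder_class \<alpha> (2 * B) B" "g \<in> hoelder_class \<alpha> (2 * B) B"
    using osc B(3) order_trans unfolding hoelder_class_def by blast+
  define t where "t = 2 * B + B / K"
  have ft: "f \<in> hoelder_class \<alpha> t (t * K)" "g \<in> hoelder_class \<alpha> t (t * K)"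
    unfolding t_def using fg B(1) by (auto intro: hoelder_class_balanced)
  have [measurable]: "f \<in> borel_measurable \<nu>" "g \<in> borel_measurable \<nu>"
    using fg hoelder_class_measurable[OF alpha(1)] measurable_cong_sets[OF sets refl] by blast+
  have "\<phi> \<in> borel_measurable \<nu>"
    unfolding borel_measurable_complex_iff by (simp add: \<phi>)
  then have "integrable \<nu> \<phi>"
    using B(2) by (intro \<nu>.integrable_const_bound[where B = B]) auto
  then have "(\<integral>y. \<phi> y \<partial>\<nu>) = Complex (\<integral>y. f y \<partial>\<nu>) (\<integral>y. g y \<partial>\<nu>)"
    by (simp add: complex_eq_iff f_def g_def)
  moreover have "(transition_op \<mu> ^^ n) \<phi> x = Complex ((P ^^ n) f x) ((P ^^ n) g x)"
    using transition_op_pow_Complex[OF fg B(1)] by (simp add: \<phi>)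
  ultimately have "cmod ((transition_op \<mu> ^^ n) \<phi> x - (\<integral>y. \<phi> y \<partial>\<nu>))
      \<le> \<bar>(P ^^ n) f x - (\<integral>y. f y \<partial>\<nu>)\<bar> + \<bar>(P ^^ n) g x - (\<integral>y. g y \<partial>\<nu>)\<bar>"
    using cmod_le[of "Complex ((P ^^ n) f x) ((P ^^ n) g x) - Complex (\<integral>y. f y \<partial>\<nu>) (\<integral>y. g y \<partial>\<nu>)"] by simp
  also have "\<dots> \<le> C * \<theta> ^ n * t + C * \<theta> ^ n * t"
    by (intro add_mono invariant_rate[OF \<nu>] ft)
  also have "\<dots> = 2 * C * (2 + 1 / K) * \<theta> ^ n * B"
    by (simp add: t_def algebra_simps)
  finally show ?thesis .
qed

lemma hoelder_norm_rate:
  assumes \<nu>: "invariant_prob \<mu> \<nu>"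
  shows "ennreal (cmod ((transition_op \<mu> ^^ n) \<phi> x - (\<integral>y. \<phi> y \<partial>\<nu>)))
    \<le> ennreal (2 * C * (2 + 1 / K) * \<theta> ^ n) * hoelder_norm \<alpha> \<phi>"
proof (cases "hoelder_norm \<alpha> \<phi>")
  case (real B)
  have pos: "0 < 2 * C * (2 + 1 / K) * \<theta> ^ n"
    using C K \<theta> by (intro mult_pos_pos add_pos_pos) auto
  have "ennreal (cmod (\<phi> x)) \<le> ennreal B" for x
  proof -
    have "ennreal (cmod (\<phi> x)) \<le> (SUP x. ennreal (cmod (\<phi> x)))"
      by (rule SUP_upper) simp
    also have "\<dots> \<le> hoelder_norm \<alpha> \<phi>"
      by (simp add: hoelder_norm_def)
    finally show ?thesis
      by (simp add: real)
  qed
  then have sup: "cmod (\<phi> x) \<le> B" for x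
    using real(1) by (simp add: ennreal_le_iff)
  have hoelder: "cmod (\<phi> x - \<phi> y) \<le> B * dist x y powr \<alpha>" for x y
  proof (cases "x = y")
    case False
    have "ennreal (cmod (\<phi> x - \<phi> y) / dist x y powr \<alpha>) \<le> hoelder_seminorm \<alpha> \<phi>"
      unfolding hoelder_seminorm_def using False by (intro SUP_upper2[of "(x, y)"]) auto
    also have "\<dots> \<le> hoelder_norm \<alpha> \<phi>"
      by (simp add: hoelder_norm_def)
    finally have "cmod (\<phi> x - \<phi> y) / dist x y powr \<alpha> \<le> B"
      using real by (simp add: ennreal_le_iff)
    then show ?thesis
      using False by (simp add: field_simps)
  qed simp
  have "ennreal (cmod ((transition_op \<mu> ^^ n) \<phi> x - (\<integral>y. \<phi> y \<partial>\<nu>)))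
      \<le> ennreal (2 * C * (2 + 1 / K) * \<theta> ^ n * B)"
    by (intro ennreal_leI complex_rate[OF \<nu> real(1) sup hoelder])
  also have "\<dots> = ennreal (2 * C * (2 + 1 / K) * \<theta> ^ n) * hoelder_norm \<alpha> \<phi>"
    using pos real by (simp add: ennreal_mult)
  finally show ?thesis .
next
  \<comment> \<open>The prefactor is positive, so an infinite norm makes the right-hand side
    infinite.\<close>
  case top
  have pos: "0 < 2 * C * (2 + 1 / K) * \<theta> ^ n"
    using C K \<theta> by (intro mult_pos_pos add_pos_pos) auto
  then have "ennreal (2 * C * (2 + 1 / K) * \<theta> ^ n) \<noteq> 0"
    by (simp only: ennreal_eq_0_iff not_le)
  then have "ennreal (2 * C * (2 + 1 / K) * \<theta> ^ n) * hoelder_norm \<alpha> \<phi> = \<top>"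
    unfolding top by (subst ennreal_mult_top) simp
  then show ?thesis
    by simp
qed

end

theorem theorem2p3:
  fixes \<mu> :: "'a::metric_space \<Rightarrow> ('a \<Rightarrow>\<^sub>C 'a) measure"
    and \<alpha> :: real
  assumes E_compact: "compact (UNIV :: 'a set)"
    and prob: "\<And>x. prob_on_Lip (\<mu> x)"
    and cont: "weakly_continuous_family \<mu>"
    and alpha: "0 < \<alpha>" "\<alpha> \<le> 1"
    and contraction:
      "(SUP (x, y) \<in> {(x, y). x \<noteq> y}.
          \<integral>\<^sup>+T. ennreal ((dist (apply_bcontfun T x) (apply_bcontfun T y) / dist x y) powr \<alpha>) \<partial>\<mu> x) < 1"
    and tv_hoelder:
      "(SUP (x, y) \<in> {(x, y). x \<noteq> y}. tv_norm (\<mu> x) (\<mu> y) / ennreal (dist x y powr \<alpha>)) < \<infinity>"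
    and minorization:
      "\<exists>\<delta>>0. \<exists>m. prob_on_Lip m
          \<and> (\<forall>x. \<forall>A\<in>sets m. ennreal \<delta> * emeasure m A \<le> emeasure (\<mu> x) A)
          \<and> (\<exists>\<xi>. (\<forall>n. \<xi> n \<in> closed_semigroup (measure_support m)) \<and> contracting_sequence \<xi>)"
  shows "(\<exists>!\<nu>. invariant_prob \<mu> \<nu>) \<and>
    (\<forall>\<nu>. invariant_prob \<mu> \<nu> \<longrightarrow>
      (\<exists>\<kappa>>0. \<exists>\<rho>. 0 < \<rho> \<and> \<rho> < 1 \<and>
        (\<forall>\<phi> \<in> hoelder_space \<alpha>. \<forall>x. \<forall>n.
          ennreal (cmod ((transition_op \<mu> ^^ n) \<phi> x - (\<integral>y. \<phi> y \<partial>\<nu>)))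
            \<le> ennreal (\<kappa> * \<rho> ^ n) * hoelder_norm \<alpha> \<phi>)))"
proof -
  \<comment> \<open>Both suprema are finite, hence represented by nonnegative reals.\<close>
  obtain r where r: "0 \<le> r" "r < 1" and r_eq: "(SUP (x, y) \<in> {(x, y). x \<noteq> y}.
      \<integral>\<^sup>+T. ennreal ((dist (apply_bcontfun T x) (apply_bcontfun T y) / dist x y) powr \<alpha>) \<partial>\<mu> x) = ennreal r"
    (is "?r = _")
    using contraction by (cases ?r) auto
  obtain R where R: "0 \<le> R" and R_eq:
    "(SUP (x, y) \<in> {(x, y). x \<noteq> y}. tv_norm (\<mu> x) (\<mu> y) / ennreal (dist x y powr \<alpha>)) = ennreal R"
    (is "?R = _")
    using tv_hoelder by (cases ?R) auto
  obtain \<delta> m \<xi> where \<delta>: "0 < \<delta>" and m: "prob_on_Lip m"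
    and minor: "\<And>x A. A \<in> sets m \<Longrightarrow> ennreal \<delta> * emeasure m A \<le> emeasure (\<mu> x) A"
    and \<xi>: "\<And>n. \<xi> n \<in> closed_semigroup (measure_support m)" "contracting_sequence \<xi>"
    using minorization by blast
  \<comment> \<open>Off the diagonal the supremum bounds are multiplied by
    \<open>dist x y powr \<alpha>\<close>, which is positive and finite; on the diagonal both sides
    vanish.\<close>
  interpret minorized_hoelder_chain \<mu> \<alpha> r R \<delta> m
  proof
    fix x y
    show "(\<integral>\<^sup>+T. ennreal (dist (apply_bcontfun T x) (apply_bcontfun T y) powr \<alpha>) \<partial>\<mu> x)
        \<le> ennreal (r * dist x y powr \<alpha>)"
    proof (cases "x = y")
      case False
      let ?I = "\<integral>\<^sup>+T. ennreal ((dist (apply_bcontfun T x) (apply_bcontfun T y) / dist x y) powr \<alpha>) \<partial>\<mu> x"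
      have [measurable]: "(\<lambda>T. dist (apply_bcontfun T x) (apply_bcontfun T y)) \<in> borel_measurable (\<mu> x)"
        by (rule prob_on_Lip_measurable_dist[OF prob])
      have "?I \<le> ?r"
        using False by (intro SUP_upper2[of "(x, y)"]) auto
      then have "ennreal (dist x y powr \<alpha>) * ?I \<le> ennreal (dist x y powr \<alpha>) * ennreal r"
        unfolding r_eq by (rule mult_left_mono) simp
      moreover have "(\<integral>\<^sup>+T. ennreal (dist (apply_bcontfun T x) (apply_bcontfun T y) powr \<alpha>) \<partial>\<mu> x)
          = ennreal (dist x y powr \<alpha>) * ?I"
        using False by (subst nn_integral_cmult[symmetric])
          (auto simp: powr_divide simp flip: ennreal_mult intro!: nn_integral_cong)
      ultimately show ?thesis
        using r(1) by (simp add: mult.commute flip: ennreal_mult)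
    qed simp
    show "tv_norm (\<mu> x) (\<mu> y) \<le> ennreal (R * dist x y powr \<alpha>)"
    proof (cases "x = y")
      case True
      have "tv_norm (\<mu> x) (\<mu> y) \<le> 0"
        unfolding tv_norm_def True by (intro SUP_least) simp
      then show ?thesis
        by simp
    next
      case False
      have "tv_norm (\<mu> x) (\<mu> y) / ennreal (dist x y powr \<alpha>) \<le> ?R"
        using False by (intro SUP_upper2[of "(x, y)"]) auto
      then have "ennreal (dist x y powr \<alpha>) * (tv_norm (\<mu> x) (\<mu> y) / ennreal (dist x y powr \<alpha>))
          \<le> ennreal (dist x y powr \<alpha>) * ennreal R"
        unfolding R_eq by (rule mult_left_mono) simp
      moreover have "ennreal (dist x y powr \<alpha>) * (tv_norm (\<mu> x) (\<mu> y) / ennreal (dist x y powr \<alpha>))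
          = tv_norm (\<mu> x) (\<mu> y)"
        using False by (simp add: ennreal_times_divide mult.commute ennreal_mult_divide_eq)
      ultimately show ?thesis
        using R by (simp add: mult.commute flip: ennreal_mult)
    qed
  qed (use prob alpha r R \<delta> m minor in auto)
  obtain e n where ne: "0 < e" "\<And>x y. merging n e x y"
  proof (rule uniform_merging[OF E_compact merging_all_pairs[OF \<xi>]])
    fix e n assume "0 < e" "\<And>x y. merging n e x y"
    then show thesis
      by (rule that)
  qed
  obtain C \<theta> where C: "0 < C" and \<theta>: "0 < \<theta>" "\<theta> < 1" and decay:
    "\<And>f t k x y. f \<in> hoelder_class \<alpha> t (t * K) \<Longrightarrow> \<bar>(P ^^ k) f x - (P ^^ k) f y\<bar> \<le> C * \<theta> ^ k * t"
    using geometric_decay[OF ne] by metis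
  interpret erg: ergodic_hoelder_chain \<mu> \<alpha> r R K C \<theta>
    by unfold_locales (use K C \<theta> decay in auto)
  \<comment> \<open>This is the constant delivered by \<open>hoelder_norm_rate\<close>; it is the
    same for all \<open>\<phi>\<close>, \<open>x\<close> and \<open>n\<close>.\<close>
  have \<kappa>: "0 < 2 * C * (2 + 1 / K)"
    using C K by (intro mult_pos_pos add_pos_pos) auto
  show ?thesis
  proof (intro conjI allI impI)
    show "\<exists>!\<nu>. invariant_prob \<mu> \<nu>"
      using erg.invariant_exists[OF E_compact] erg.invariant_unique by (intro ex_ex1I)
    fix \<nu> assume "invariant_prob \<mu> \<nu>"
    then show "\<exists>\<kappa>>0. \<exists>\<rho>. 0 < \<rho> \<and> \<rho> < 1 \<and>
        (\<forall>\<phi> \<in> hoelder_space \<alpha>. \<forall>x. \<forall>n.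
          ennreal (cmod ((transition_op \<mu> ^^ n) \<phi> x - (\<integral>y. \<phi> y \<partial>\<nu>)))
            \<le> ennreal (\<kappa> * \<rho> ^ n) * hoelder_norm \<alpha> \<phi>)"
      by (intro exI[of _ "2 * C * (2 + 1 / K)"] exI[of _ \<theta>] conjI \<kappa> \<theta> ballI allI erg.hoelder_norm_rate)
  qed
qed

end
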